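(* Let $H$ be a $3$-graph which is tightly connected and not tripartite. Then there exist constants $c>0$ and $n_0$ such that $r(H, K_n^{(3)}) \ge 2^{c\, n^{2/3}}$ for all $n \ge n_0$.
   Context: A $3$-graph is a $3$-uniform hypergraph. $K_N^{(3)}$ denotes the complete $3$-graph on $N$ vertices. The off-diagonal Ramsey number $r(H, K_n^{(3)})$ is the smallest natural number $N$ such that every red/blue-coloring of the edges of $K_N^{(3)}$ contains either a red copy of $H$ or a blue copy of $K_n^{(3)}$. A $3$-graph $H$ is tightly connected if for any two edges $e,f$ of $H$ there is a sequence of edges $e=e_0,e_1,\dots,e_t=f$ such that $e_{i-1}$ and $e_i$ share two vertices for all $i=1,\dots,t$. A $3$-graph is tripartite if its vertex set can be partitioned into three parts so that every edge has exactly one vertex in each part. *)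

theory Defs
  imports Complex_Main "HOL-Library.Ramsey"
begin

definition three_graph :: "'a set \<Rightarrow> 'a set set \<Rightarrow> bool" where
  "three_graph V E \<longleftrightarrow> finite V \<and> E \<subseteq> nsets V 3"

definition tightly_connected :: "'a set set \<Rightarrow> bool" where
  "tightly_connected E \<longleftrightarrow>
     (\<forall>e\<in>E. \<forall>f\<in>E. \<exists>(t::nat) (s :: nat \<Rightarrow> 'a set).
        s 0 = e \<and> s t = f \<and> (\<forall>i\<le>t. s i \<in> E) \<and>
        (\<forall>i\<in>{1..t}. card (s (i - 1) \<inter> s i) = 2))"

text \<open>The parts may be empty, so that every 3-graph without edges is tripartite.\<close>

definition tripartite :: "'a set \<Rightarrow> 'a set set \<Rightarrow> bool" where
  "tripartite V E \<longleftrightarrow>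
     (\<exists>A B C. A \<union> B \<union> C = V \<and> A \<inter> B = {} \<and> A \<inter> C = {} \<and> B \<inter> C = {} \<and>
        (\<forall>e\<in>E. card (e \<inter> A) = 1 \<and> card (e \<inter> B) = 1 \<and> card (e \<inter> C) = 1))"

text \<open>A copy of \<open>(V, E)\<close> in \<open>(W, F)\<close> need not be induced.\<close>

definition contains_copy :: "'b set \<Rightarrow> 'b set set \<Rightarrow> 'a set \<Rightarrow> 'a set set \<Rightarrow> bool" where
  "contains_copy W F V E \<longleftrightarrow>
     (\<exists>\<phi>. inj_on \<phi> V \<and> \<phi> ` V \<subseteq> W \<and> (\<forall>e\<in>E. \<phi> ` e \<in> F))"

datatype colour = Red | Blue

definition colour_class :: "nat \<Rightarrow> (nat set \<Rightarrow> colour) \<Rightarrow> colour \<Rightarrow> nat set set" where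
  "colour_class N \<chi> k = {e \<in> nsets {..<N} 3. \<chi> e = k}"

definition ramsey_prop :: "'a set \<Rightarrow> 'a set set \<Rightarrow> nat \<Rightarrow> nat \<Rightarrow> bool" where
  "ramsey_prop V E n N \<longleftrightarrow>
     (\<forall>\<chi>. contains_copy {..<N} (colour_class N \<chi> Red) V E \<or>
          contains_copy {..<N} (colour_class N \<chi> Blue) {..<n} (nsets {..<n} 3))"

text \<open>\<open>ramsey_number V E n\<close> is $r(H, K_n^{(3)})$ for $H = (V, E)$; the lemma below shows that
  the minimum is over a nonempty set.\<close>

definition ramsey_number :: "'a set \<Rightarrow> 'a set set \<Rightarrow> nat \<Rightarrow> nat" where
  "ramsey_number V E n = (LEAST N. ramsey_prop V E n N)"

lemma contains_copy_clique:
  assumes "finite V" "E \<subseteq> nsets V 3" "X \<in> nsets W (card V)" "nsets X 3 \<subseteq> F"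
  shows "contains_copy W F V E"
proof -
  have X: "X \<subseteq> W" "finite X" "card X = card V"
    using assms(3) by (auto simp: nsets_def)
  obtain h where h: "bij_betw h V X"
    using finite_same_card_bij[OF assms(1) X(2)] X(3) by auto
  have "h ` e \<in> F" if "e \<in> E" for e
  proof -
    have e: "e \<subseteq> V" "finite e" "card e = 3"
      using that assms(2) by (auto simp: nsets_def)
    have "card (h ` e) = 3"
      using e h by (metis bij_betw_def card_image inj_on_subset)
    then have "h ` e \<in> nsets X 3"
      using e h by (auto simp: nsets_def bij_betw_def)
    then show ?thesis using assms(4) by blast
  qed
  then show ?thesis
    using h X(1) unfolding contains_copy_def bij_betw_def by blast
qed

lemma ramsey_prop_exists:
  assumes "three_graph V E"
  shows "\<exists>N. ramsey_prop V E n N"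
proof -
  obtain N :: nat where N: "partn_lst {..<N} [card V, n] 3"
    using ramsey_full[of "[card V, n]" 3] by blast
  have "ramsey_prop V E n N"
    unfolding ramsey_prop_def
  proof
    fix \<chi> :: "nat set \<Rightarrow> colour"
    define g where "g = (\<lambda>e. if \<chi> e = Red then 0 else 1 :: nat)"
    have g: "g \<in> nsets {..<N} 3 \<rightarrow> {..<length [card V, n]}"
      by (auto simp: g_def)
    obtain i X where i: "i < 2" and X: "X \<in> nsets {..<N} ([card V, n] ! i)"
      and gX: "g ` nsets X 3 \<subseteq> {i}"
      using N[unfolded partn_lst_def monochromatic_def, rule_format, OF g] by (auto simp: numeral_2_eq_2)
    have sub: "nsets X 3 \<subseteq> nsets {..<N} 3"
      using X by (auto simp: nsets_def)
    show "contains_copy {..<N} (colour_class N \<chi> Red) V E \<or>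
          contains_copy {..<N} (colour_class N \<chi> Blue) {..<n} (nsets {..<n} 3)"
    proof (cases "i = 0")
      case True
      have "nsets X 3 \<subseteq> colour_class N \<chi> Red"
        using sub gX True by (auto simp: colour_class_def g_def split: if_splits)
      then show ?thesis
        using contains_copy_clique[of V E X "{..<N}"] X True assms
        by (auto simp: three_graph_def)
    next
      case False
      then have i1: "i = 1" using i by simp
      have "\<chi> e = Blue" if "e \<in> nsets X 3" for e
        using gX that i1 by (cases "\<chi> e") (auto simp: g_def)
      then have "nsets X 3 \<subseteq> colour_class N \<chi> Blue"
        using sub by (auto simp: colour_class_def)
      then show ?thesis
        using contains_copy_clique[of "{..<n}" "nsets {..<n} 3" X "{..<N}"] X i1
        by auto
    qed
  qed
  then show ?thesis by blast
qed

end

theory Submission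
  imports Defs "HOL-Real_Asymp.Real_Asymp"
begin

text \<open>Give every pair of vertices a random index \<open>i < m\<close> and, for every \<open>i\<close>, every vertex a random part
  in \<open>{0, 1, 2}\<close>. A triple is red if its three pairs have the same index \<open>i\<close> and its vertices lie in
  different parts for \<open>i\<close>. Edges that share two vertices have the same index, so a red copy of a
  tightly connected \<open>H\<close> uses a single index, whose parts show that \<open>H\<close> is tripartite.

  Let \<open>m\<close> be of order \<open>n\<^sup>2\<^sup>/\<^sup>3\<close>. An \<open>n\<close>-set can avoid red triples in two ways. Its vertices can be spread
  unevenly over the parts for a positive fraction of the indices, with probability \<open>exp (- c n m)\<close>; or
  the indices of the pairs are to blame, with probability about \<open>exp (- c n\<^sup>3 / m\<^sup>2)\<close>. Both are
  \<open>exp (- c n\<^sup>5\<^sup>/\<^sup>3)\<close>, which beats the number \<open>N ^ n\<close> of \<open>n\<close>-sets for \<open>N = exp (c' n\<^sup>2\<^sup>/\<^sup>3)\<close>.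

  For the second bound, take disjoint \<open>T, U, W\<close> of size \<open>n / 3\<close> in the set and reveal the pairs from \<open>T\<close> to \<open>U\<close> and \<open>W\<close>
  first. Each \<open>t \<in> T\<close> forbids the index \<open>i\<close> for about \<open>n\<^sup>2 / m\<close> triples \<open>(u, w, i)\<close>, and these are
  mostly new for each \<open>t\<close>, so that in the end the pairs between \<open>U\<close> and \<open>W\<close> have to avoid about
  \<open>n\<^sup>3 / m\<close> forbidden values, each of which is taken with probability \<open>1 / m\<close>.\<close>

section \<open>Exponential sums bounding the pair colourings without a red transversal
  triple\<close>

lemma sum_PiE_insert:
  fixes F :: "_ \<Rightarrow> real"
  assumes "t \<notin> T"
  shows "(\<Sum>h\<in>insert t T \<rightarrow>\<^sub>E X. F h) = (\<Sum>x\<in>X. \<Sum>h\<in>T \<rightarrow>\<^sub>E X. F (h(t := x)))"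
proof -
  have "(\<Sum>h\<in>insert t T \<rightarrow>\<^sub>E X. F h) = (\<Sum>p\<in>X \<times> (T \<rightarrow>\<^sub>E X). F ((\<lambda>(y, g). g(t := y)) p))"
    unfolding PiE_insert_eq
    by (subst sum.reindex) (auto intro!: inj_combinator[OF assms])
  then show ?thesis
    by (simp add: sum.cartesian_product split_def)
qed

text \<open>The sets are added one at a time: as long as the union has at most \<open>L\<close> elements, the next set
  costs a factor \<open>\<rho>\<close>; once it is larger, the last summand of the bound takes over.\<close>

lemma sum_exp_card_UN_le:
  fixes B :: "'t \<Rightarrow> 'x \<Rightarrow> 'b set" and l \<rho> L :: real
  assumes fin: "finite T" "finite X" "finite \<Omega>" and l: "l \<ge> 0" and \<rho>: "\<rho> \<ge> 0"
    and sub: "\<And>t x. t \<in> T \<Longrightarrow> x \<in> X \<Longrightarrow> B t x \<subseteq> \<Omega>"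
    and step: "\<And>t D. t \<in> T \<Longrightarrow> D \<subseteq> \<Omega> \<Longrightarrow> real (card D) \<le> L \<Longrightarrow>
                 (\<Sum>x\<in>X. exp (- l * real (card (B t x - D)))) \<le> real (card X) * \<rho>"
    and D: "D \<subseteq> \<Omega>"
  shows "(\<Sum>h\<in>T \<rightarrow>\<^sub>E X. exp (- l * real (card (D \<union> (\<Union>t\<in>T. B t (h t))))))
          \<le> real (card X) ^ card T * (exp (- l * real (card D)) * \<rho> ^ card T + exp (- l * L))"
  using fin(1) sub step D
proof (induction T arbitrary: D rule: finite_induct)
  case empty
  then show ?case by simp
next
  case (insert t T)
  let ?N = "real (card X)"
  have fD: "finite D"
    using insert.prems(3) fin(3) by (rule finite_subset)
  show ?case
  proof (cases "real (card D) \<le> L")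
    case False
    have "exp (- l * real (card (D \<union> (\<Union>s\<in>insert t T. B s (h s))))) \<le> exp (- l * L)"
      if "h \<in> insert t T \<rightarrow>\<^sub>E X" for h
    proof -
      have "(\<Union>s\<in>insert t T. B s (h s)) \<subseteq> \<Omega>"
        using insert.prems(1) that by blast
      then have "finite (D \<union> (\<Union>s\<in>insert t T. B s (h s)))"
        using insert.prems(3) fin(3) by (meson Un_least finite_subset)
      then have "card D \<le> card (D \<union> (\<Union>s\<in>insert t T. B s (h s)))"
        by (intro card_mono) auto
      then have "real (card D) \<le> real (card (D \<union> (\<Union>s\<in>insert t T. B s (h s))))"
        by (rule of_nat_mono)
      with False show ?thesis
        using l by (auto intro!: mult_left_mono)
    qed
    then have "(\<Sum>h\<in>insert t T \<rightarrow>\<^sub>E X. exp (- l * real (card (D \<union> (\<Union>s\<in>insert t T. B s (h s))))))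
       \<le> (\<Sum>h\<in>insert t T \<rightarrow>\<^sub>E X. exp (- l * L))"
      by (intro sum_mono)
    also have "\<dots> = ?N ^ card (insert t T) * exp (- l * L)"
      using insert.hyps(1) by (simp add: card_PiE del: card_insert_disjoint)
    also have "\<dots> \<le> ?N ^ card (insert t T) *
        (exp (- l * real (card D)) * \<rho> ^ card (insert t T) + exp (- l * L))"
      using \<rho> by (intro mult_left_mono) auto
    finally show ?thesis .
  next
    case True
    have IH: "(\<Sum>h\<in>T \<rightarrow>\<^sub>E X. exp (- l * real (card (D \<union> B t x \<union> (\<Union>s\<in>T. B s (h s))))))
          \<le> ?N ^ card T * (exp (- l * real (card (D \<union> B t x))) * \<rho> ^ card T + exp (- l * L))"
      if "x \<in> X" for x
      using insert.prems that by (intro insert.IH) auto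
    \<comment> \<open>Only the elements of \<open>B t x\<close> outside \<open>D\<close> enlarge the
      union, so the weight factors; \<open>step\<close> then controls the sum over \<open>x\<close>
      of the second factor.\<close>
    have split: "exp (- l * real (card (D \<union> B t x)))
        = exp (- l * real (card D)) * exp (- l * real (card (B t x - D)))" if "x \<in> X" for x
    proof -
      have "finite (B t x)"
        using insert.prems(1)[of t x] that fin(3) by (auto intro: finite_subset)
      then have "card (D \<union> B t x) = card D + card (B t x - D)"
        using fD card_Un_disjoint[of D "B t x - D"] by (simp add: Diff_disjoint)
      then show ?thesis
        by (simp add: exp_add [symmetric] algebra_simps)
    qed
    have "(\<Sum>h\<in>insert t T \<rightarrow>\<^sub>E X. exp (- l * real (card (D \<union> (\<Union>s\<in>insert t T. B s (h s))))))
      = (\<Sum>x\<in>X. \<Sum>h\<in>T \<rightarrow>\<^sub>E X. exp (- l * real (card (D \<union> B t x \<union> (\<Union>s\<in>T. B s (h s))))))"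
    proof (subst sum_PiE_insert[OF insert.hyps(2)], intro sum.cong refl)
      fix x h
      have "(\<Union>s\<in>insert t T. B s ((h(t := x)) s)) = B t x \<union> (\<Union>s\<in>T. B s (h s))"
        using insert.hyps(2) by (auto split: if_split_asm)
      then show "exp (- l * real (card (D \<union> (\<Union>s\<in>insert t T. B s ((h(t := x)) s)))))
         = exp (- l * real (card (D \<union> B t x \<union> (\<Union>s\<in>T. B s (h s)))))"
        by (simp only: Un_assoc)
    qed
    also have "\<dots> \<le> (\<Sum>x\<in>X. ?N ^ card T *
        (exp (- l * real (card (D \<union> B t x))) * \<rho> ^ card T + exp (- l * L)))"
      by (intro sum_mono IH)
    also have "\<dots> = (\<Sum>x\<in>X. ?N ^ card T * (exp (- l * real (card D)) *
        exp (- l * real (card (B t x - D))) * \<rho> ^ card T + exp (- l * L)))"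
      by (intro sum.cong refl) (simp only: split)
    also have "\<dots> = ?N ^ card T * exp (- l * real (card D)) * \<rho> ^ card T *
          (\<Sum>x\<in>X. exp (- l * real (card (B t x - D)))) + ?N ^ Suc (card T) * exp (- l * L)"
      by (simp add: sum_distrib_left sum.distrib algebra_simps)
    also have "\<dots> \<le> ?N ^ card T * exp (- l * real (card D)) * \<rho> ^ card T * (?N * \<rho>)
        + ?N ^ Suc (card T) * exp (- l * L)"
      using insert.prems True \<rho> by (intro add_right_mono mult_left_mono) auto
    also have "\<dots> = ?N ^ card (insert t T) *
        (exp (- l * real (card D)) * \<rho> ^ card (insert t T) + exp (- l * L))"
      using insert.hyps by (simp add: algebra_simps)
    finally show ?thesis .
  qed
qed

text \<open>The last summand of the bound accounts for the \<open>a\<close> that take some value more than \<open>m\<close> times; for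
  all other \<open>a\<close> every exponent is at most 1, where \<open>exp (- x) \<le> 1 - x / 2\<close>.\<close>

lemma sum_exp_match_le:
  fixes q :: "'u \<Rightarrow> 'w \<Rightarrow> nat \<Rightarrow> real" and m :: nat
  assumes fin: "finite U" "finite W" and m: "m > 0"
    and q: "\<And>u w i. 0 \<le> q u w i" "\<And>u w i. q u w i \<le> 1"
    and W: "card W \<le> 2 * m\<^sup>2"
  shows "(\<Sum>a\<in>U \<rightarrow>\<^sub>E {..<m}. \<Sum>b\<in>W \<rightarrow>\<^sub>E {..<m}.
            exp (- (\<Sum>w\<in>W. \<Sum>u\<in>U. if a u = b w then q u w (b w) else 0) / real m))
         \<le> real m ^ card U * real m ^ card W *
           (exp (- (\<Sum>u\<in>U. \<Sum>i<m. \<Sum>w\<in>W. q u w i) / (4 * real m ^ 3))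
            + real m * (1 + 1 / real m) ^ card U / 2 ^ m)"
proof -
  define s where "s a w j = (\<Sum>u\<in>U. if a u = j then q u w j else 0)" for a w j
  define d where "d u i = (\<Sum>w\<in>W. q u w i)" for u i
  define c where "c a j = card {u \<in> U. a u = j}" for a :: "'u \<Rightarrow> nat" and j
  have s0: "0 \<le> s a w j" for a w j
    by (auto simp: s_def q intro!: sum_nonneg)
  have d0: "0 \<le> d u i" for u i
    by (auto simp: d_def q intro!: sum_nonneg)
  have dW: "d u i \<le> real (card W)" for u i
    using sum_mono[of W "\<lambda>w. q u w i" "\<lambda>_. 1"] q by (simp add: d_def)
  have sc: "s a w j \<le> real (c a j)" for a w j
  proof -
    have "s a w j \<le> (\<Sum>u\<in>U. if a u = j then 1 else 0)"
      unfolding s_def by (intro sum_mono) (auto simp: q)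
    also have "\<dots> = real (c a j)"
      using fin by (simp add: c_def sum.If_cases Int_def)
    finally show ?thesis .
  qed
  have expb: "exp (- x) \<le> 1 - x / 2" if "0 \<le> x" "x \<le> 1" for x :: real
  proof -
    have "x * x \<le> x * 1" using that by (intro mult_left_mono) auto
    then have "1 \<le> (1 - x/2) * (1 + x)" using that by (simp add: algebra_simps)
    also have "\<dots> \<le> (1 - x/2) * exp x" 
      using that by (intro mult_left_mono) auto
    finally show ?thesis by (simp add: exp_minus field_simps)
  qed
  \<comment> \<open>A reverse of Jensen's inequality that loses a factor 2 in the exponent: bound
    each term linearly, then use \<open>1 + y \<le> exp y\<close> for the mean. It is applied twice,
    to the values of \<open>b\<close> and then to those of \<open>a\<close>.\<close>
  have avg: "(\<Sum>j<m. exp (- f j)) \<le> real m * exp (- (\<Sum>j<m. f j) / (2 * real m))"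
    if "\<And>j. j < m \<Longrightarrow> 0 \<le> f j" "\<And>j. j < m \<Longrightarrow> f j \<le> 1" for f :: "nat \<Rightarrow> real"
  proof -
    have "(\<Sum>j<m. exp (- f j)) \<le> (\<Sum>j<m. 1 - f j / 2)"
      using that by (intro sum_mono expb) auto
    also have "\<dots> = real m * (1 + (- (\<Sum>j<m. f j) / (2 * real m)))"
      using m by (simp add: sum_subtractf sum_divide_distrib [symmetric] field_simps)
    also have "\<dots> \<le> real m * exp (- (\<Sum>j<m. f j) / (2 * real m))"
      by (intro mult_left_mono exp_ge_add_one_self) auto
    finally show ?thesis .
  qed
  have inner: "(\<Sum>b\<in>W \<rightarrow>\<^sub>E {..<m}. exp (- (\<Sum>w\<in>W. s a w (b w)) / real m))
     \<le> real m ^ card W * ((\<Prod>u\<in>U. exp (- (d u (a u) / (2 * (real m)\<^sup>2)))) + (\<Sum>j<m. 2 ^ c a j / 2 ^ m))"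
    if a: "a \<in> U \<rightarrow>\<^sub>E {..<m}" for a
  proof -
    have eq: "(\<Sum>b\<in>W \<rightarrow>\<^sub>E {..<m}. exp (- (\<Sum>w\<in>W. s a w (b w)) / real m))
       = (\<Prod>w\<in>W. \<Sum>j<m. exp (- (s a w j / real m)))"
      using fin by (subst prod_sum_PiE) (auto simp: exp_sum sum_negf [symmetric] sum_divide_distrib)
    show ?thesis
    proof (cases "\<forall>j<m. c a j \<le> m")
      case True
      have "(\<Prod>w\<in>W. \<Sum>j<m. exp (- (s a w j / real m)))
        \<le> (\<Prod>w\<in>W. real m * exp (- (\<Sum>j<m. s a w j / real m) / (2 * real m)))"
      proof (intro prod_mono conjI avg)
        fix w j assume "j < m"
        with True have "real (c a j) \<le> real m" by auto
        with sc[of a w j] show "s a w j / real m \<le> 1" using m by simp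
      qed (use s0 m in \<open>auto intro!: sum_nonneg\<close>)
      also have "\<dots> = real m ^ card W * exp (- (\<Sum>w\<in>W. \<Sum>j<m. s a w j) / (2 * (real m)\<^sup>2))"
        using fin by (simp add: prod.distrib exp_sum [symmetric] sum_negf sum_divide_distrib [symmetric]
            power2_eq_square field_simps)
      also have "(\<Sum>w\<in>W. \<Sum>j<m. s a w j) = (\<Sum>u\<in>U. d u (a u))"
      proof -
        have "(\<Sum>w\<in>W. \<Sum>j<m. s a w j) = (\<Sum>w\<in>W. \<Sum>u\<in>U. \<Sum>j<m. if a u = j then q u w j else 0)"
          unfolding s_def by (subst sum.swap) simp
        also have "\<dots> = (\<Sum>w\<in>W. \<Sum>u\<in>U. q u w (a u))"
          using a by (intro sum.cong refl) (auto simp: PiE_iff)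
        also have "\<dots> = (\<Sum>u\<in>U. d u (a u))"
          unfolding d_def by (rule sum.swap)
        finally show ?thesis .
      qed
      also have "exp (- (\<Sum>u\<in>U. d u (a u)) / (2 * (real m)\<^sup>2)) = (\<Prod>u\<in>U. exp (- (d u (a u) / (2 * (real m)\<^sup>2))))"
        using fin by (simp add: exp_sum [symmetric] sum_negf sum_divide_distrib)
      also have "real m ^ card W * \<dots> \<le> real m ^ card W * (\<dots> + (\<Sum>j<m. 2 ^ c a j / 2 ^ m))"
        by (intro mult_left_mono) (auto intro!: sum_nonneg)
      finally show ?thesis unfolding eq .
    next
      \<comment> \<open>If some \<open>j\<close> is taken more than \<open>m\<close> times, all
        exponentials are bounded by 1, and the summand \<open>2 ^ c a j / 2 ^ m\<close> for this
        \<open>j\<close> is already at least 1. It serves as a smooth substitute for the indicator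
        of this event.\<close>
      case False
      then obtain j where j: "j < m" "c a j > m" by auto
      have "(\<Prod>w\<in>W. \<Sum>j<m. exp (- (s a w j / real m))) \<le> (\<Prod>w\<in>W. \<Sum>j<m. 1)"
        using s0 by (intro prod_mono conjI sum_mono sum_nonneg) auto
      also have "\<dots> = real m ^ card W * 1" by simp
      also have "\<dots> \<le> real m ^ card W * ((\<Prod>u\<in>U. exp (- (d u (a u) / (2 * (real m)\<^sup>2)))) + (\<Sum>j<m. 2 ^ c a j / 2 ^ m))"
      proof (intro mult_left_mono)
        have "(1::real) \<le> 2 ^ c a j / 2 ^ m"
          using j by (simp add: power_increasing)
        also have "\<dots> \<le> (\<Sum>j<m. 2 ^ c a j / 2 ^ m)"
          using j by (intro member_le_sum) auto
        finally show "1 \<le> (\<Prod>u\<in>U. exp (- (d u (a u) / (2 * (real m)\<^sup>2)))) + (\<Sum>j<m. 2 ^ c a j / 2 ^ m)"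
          by (smt (verit) prod_nonneg exp_ge_zero)
      qed auto
      finally show ?thesis unfolding eq .
    qed
  qed
  have main: "(\<Sum>a\<in>U \<rightarrow>\<^sub>E {..<m}. \<Prod>u\<in>U. exp (- (d u (a u) / (2 * (real m)\<^sup>2))))
     \<le> real m ^ card U * exp (- (\<Sum>u\<in>U. \<Sum>i<m. d u i) / (4 * real m ^ 3))"
  proof -
    have "(\<Sum>a\<in>U \<rightarrow>\<^sub>E {..<m}. \<Prod>u\<in>U. exp (- (d u (a u) / (2 * (real m)\<^sup>2))))
       = (\<Prod>u\<in>U. \<Sum>i<m. exp (- (d u i / (2 * (real m)\<^sup>2))))"
      using fin by (subst prod_sum_PiE) auto
    also have "\<dots> \<le> (\<Prod>u\<in>U. real m * exp (- (\<Sum>i<m. d u i / (2 * (real m)\<^sup>2)) / (2 * real m)))"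
    \<comment> \<open>The second averaging needs exponents of size at most 1. Since
      \<open>d u i\<close> is at most \<open>card W\<close>, this is where
      \<open>card W \<le> 2 * m\<^sup>2\<close> enters.\<close>
    proof (intro prod_mono conjI avg)
      fix u i 
      have "real (card W) \<le> real (2 * m\<^sup>2)" using W by (rule of_nat_mono)
      with dW[of u i] show "d u i / (2 * (real m)\<^sup>2) \<le> 1" using m by simp
    qed (use d0 m in \<open>auto intro!: sum_nonneg\<close>)
    also have "\<dots> = real m ^ card U * exp (- (\<Sum>u\<in>U. \<Sum>i<m. d u i) / (4 * real m ^ 3))"
      using fin by (simp add: prod.distrib exp_sum [symmetric] sum_negf sum_divide_distrib [symmetric]
            power2_eq_square power3_eq_cube field_simps)
    finally show ?thesis .
  qed
  have rest: "(\<Sum>a\<in>U \<rightarrow>\<^sub>E {..<m}. \<Sum>j<m. 2 ^ c a j / 2 ^ m :: real)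
     = real m ^ card U * (real m * (1 + 1 / real m) ^ card U / 2 ^ m)"
  proof -
    \<comment> \<open>The sum factors over \<open>U\<close>: each \<open>u\<close> contributes 2 for
      the value \<open>j\<close> and 1 for every other value, hence \<open>m + 1\<close> in
      total.\<close>
    have *: "(\<Sum>a\<in>U \<rightarrow>\<^sub>E {..<m}. 2 ^ c a j :: real) = (real m + 1) ^ card U" if "j < m" for j
    proof -
      have "(2::real) ^ c a j = (\<Prod>u\<in>U. if a u = j then 2 else 1)" for a
        using fin by (simp add: c_def prod.If_cases Int_def)
      then have "(\<Sum>a\<in>U \<rightarrow>\<^sub>E {..<m}. 2 ^ c a j :: real) = (\<Prod>u\<in>U. \<Sum>i<m. if i = j then 2 else 1)"
        using fin by (subst prod_sum_PiE) auto
      also have "(\<Sum>i<m. if i = j then 2 else 1 :: real) = (\<Sum>i<m. 1 + (if i = j then 1 else 0))"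
        by (intro sum.cong) auto
      also have "\<dots> = real m + 1"
        using that by (simp add: sum.distrib)
      finally show ?thesis by simp
    qed
    have "(\<Sum>a\<in>U \<rightarrow>\<^sub>E {..<m}. \<Sum>j<m. 2 ^ c a j / 2 ^ m :: real)
       = (\<Sum>j<m. (real m + 1) ^ card U / 2 ^ m)"
      by (subst sum.swap) (auto simp: sum_divide_distrib [symmetric] *)
    also have "real m + 1 = real m * (1 + 1 / real m)"
      using m by (simp add: field_simps)
    finally show ?thesis by (simp add: power_mult_distrib)
  qed
  have "(\<Sum>a\<in>U \<rightarrow>\<^sub>E {..<m}. \<Sum>b\<in>W \<rightarrow>\<^sub>E {..<m}.
            exp (- (\<Sum>w\<in>W. \<Sum>u\<in>U. if a u = b w then q u w (b w) else 0) / real m))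
      \<le> (\<Sum>a\<in>U \<rightarrow>\<^sub>E {..<m}. real m ^ card W * ((\<Prod>u\<in>U. exp (- (d u (a u) / (2 * (real m)\<^sup>2)))) + (\<Sum>j<m. 2 ^ c a j / 2 ^ m)))"
    using inner by (intro sum_mono) (simp add: s_def)
  also have "\<dots> = real m ^ card W * ((\<Sum>a\<in>U \<rightarrow>\<^sub>E {..<m}. \<Prod>u\<in>U. exp (- (d u (a u) / (2 * (real m)\<^sup>2))))
      + (\<Sum>a\<in>U \<rightarrow>\<^sub>E {..<m}. \<Sum>j<m. 2 ^ c a j / 2 ^ m))"
    by (simp only: sum_distrib_left [symmetric] sum.distrib)
  also have "\<dots> \<le> real m ^ card W * (real m ^ card U * exp (- (\<Sum>u\<in>U. \<Sum>i<m. d u i) / (4 * real m ^ 3))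
      + real m ^ card U * (real m * (1 + 1 / real m) ^ card U / 2 ^ m))"
    using main unfolding rest by (intro mult_left_mono add_right_mono) auto
  finally show ?thesis
    by (simp add: d_def algebra_simps)
qed

text \<open>Here \<open>h t\<close> is the colouring of the pairs from \<open>t\<close> to \<open>U\<close> and to \<open>W\<close>, and \<open>e\<close> is the colouring of
  the pairs between \<open>U\<close> and \<open>W\<close>.\<close>

lemma card_transversal_avoid_le:
  fixes Q :: "'t \<Rightarrow> ('u \<times> 'w \<times> nat) set" and m :: nat and L :: real
  assumes fin: "finite T" "finite U" "finite W" and m: "m > 0" and W: "card W \<le> 2 * m\<^sup>2"
    and Q: "\<And>t. t \<in> T \<Longrightarrow> Q t \<subseteq> U \<times> W \<times> {..<m}"
    and cQ: "\<And>t. t \<in> T \<Longrightarrow> 2 * L \<le> real (card (Q t))"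
  defines "X \<equiv> (U \<rightarrow>\<^sub>E {..<m}) \<times> (W \<rightarrow>\<^sub>E {..<m})"
  shows "real (card (SIGMA h:T \<rightarrow>\<^sub>E X. {e \<in> U \<times> W \<rightarrow>\<^sub>E {..<m}. \<forall>t\<in>T. \<forall>u\<in>U. \<forall>w\<in>W.
             \<not> ((u, w, e (u, w)) \<in> Q t \<and> fst (h t) u = e (u, w) \<and> snd (h t) w = e (u, w))}))
         \<le> real m ^ (card U * card W + (card U + card W) * card T) *
           ((exp (- L / (4 * real m ^ 3)) + real m * (1 + 1 / real m) ^ card U / 2 ^ m) ^ card T
            + exp (- L / real m))"
proof -
  \<comment> \<open>If \<open>x\<close> colours the pairs at \<open>t\<close>, then a triple
    \<open>(u, w, i)\<close> of \<open>B t x\<close> says that \<open>t\<close> forbids the value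
    \<open>i\<close> at the pair \<open>(u, w)\<close>. The set \<open>A h\<close> below collects
    everything forbidden by all of \<open>T\<close>.\<close>
  define B where "B t x = {p \<in> Q t. fst x (fst p) = snd (snd p) \<and> snd x (fst (snd p)) = snd (snd p)}"
    for t and x :: "('u \<Rightarrow> nat) \<times> ('w \<Rightarrow> nat)"
  define \<rho> where "\<rho> = exp (- L / (4 * real m ^ 3)) + real m * (1 + 1 / real m) ^ card U / 2 ^ m"
  define A where "A h = (\<Union>t\<in>T. B t (h t))" for h
  have finX: "finite X"
    unfolding X_def using fin by (intro finite_cartesian_product finite_PiE) auto
  have finE: "finite (U \<times> W \<rightarrow>\<^sub>E {..<m})"
    using fin by (intro finite_PiE) auto
  have cX: "real (card X) = real m ^ (card U + card W)"
    unfolding X_def using fin by (simp add: card_cartesian_product card_PiE power_add)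
  \<comment> \<open>The factor 2 in the hypothesis on \<open>Q t\<close> pays for \<open>D\<close>:
    as long as \<open>D\<close> has at most \<open>L\<close> elements, at least \<open>L\<close>
    triples of \<open>Q t\<close> are new. Their indicator \<open>q\<close> is the weight for the
    matching estimate.\<close>
  have step: "(\<Sum>x\<in>X. exp (- (1 / real m) * real (card (B t x - D)))) \<le> real (card X) * \<rho>"
    if t: "t \<in> T" and D: "D \<subseteq> U \<times> W \<times> {..<m}" "real (card D) \<le> L" for t D
  proof -
    define q where "q u w i = (if (u, w, i) \<in> Q t - D then 1 else 0 :: real)" for u w i
    have finQ: "finite (Q t)"
      using Q[OF t] fin by (rule_tac finite_subset) auto
    have eq: "real (card (B t (a, b) - D)) = (\<Sum>w\<in>W. \<Sum>u\<in>U. if a u = b w then q u w (b w) else 0)"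
      if ab: "a \<in> U \<rightarrow>\<^sub>E {..<m}" "b \<in> W \<rightarrow>\<^sub>E {..<m}" for a b
    proof -
      have "B t (a, b) - D = (\<lambda>(w, u). (u, w, b w)) ` {(w, u) \<in> W \<times> U. a u = b w \<and> (u, w, b w) \<in> Q t - D}"
        using Q[OF t] by (force simp: B_def image_iff)
      then have "card (B t (a, b) - D) = card {(w, u) \<in> W \<times> U. a u = b w \<and> (u, w, b w) \<in> Q t - D}"
        by (simp only:) (rule card_image, auto simp: inj_on_def)
      also have "real \<dots> = (\<Sum>(w, u)\<in>W \<times> U. if a u = b w \<and> (u, w, b w) \<in> Q t - D then 1 else 0)"
        using fin by (simp add: sum.If_cases Int_def split_def mem_Times_iff)
      also have "\<dots> = (\<Sum>w\<in>W. \<Sum>u\<in>U. if a u = b w then q u w (b w) else 0)"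
        unfolding sum.cartesian_product by (intro sum.cong) (auto simp: q_def)
      finally show ?thesis .
    qed
    have finD: "finite D"
      using D(1) fin by (rule_tac finite_subset) auto
    have "card (Q t) \<le> card (Q t - D) + card D"
      using diff_card_le_card_Diff[OF finD, of "Q t"] by simp
    then have card_Diff_le: "real (card (Q t)) \<le> real (card (Q t - D)) + real (card D)"
      by (simp flip: of_nat_add)
    have qsum: "(\<Sum>u\<in>U. \<Sum>i<m. \<Sum>w\<in>W. q u w i) \<ge> L"
    proof -
      have "(\<Sum>u\<in>U. \<Sum>i<m. \<Sum>w\<in>W. q u w i) = (\<Sum>u\<in>U. \<Sum>w\<in>W. \<Sum>i<m. q u w i)"
        by (intro sum.cong refl sum.swap)
      also have "\<dots> = (\<Sum>p\<in>U \<times> W \<times> {..<m}. if p \<in> Q t - D then 1 else 0)"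
        by (simp add: sum.cartesian_product q_def split_def)
      also have "\<dots> = real (card ((U \<times> W \<times> {..<m}) \<inter> (Q t - D)))"
        using fin by (simp add: sum.If_cases Int_def)
      also have "(U \<times> W \<times> {..<m}) \<inter> (Q t - D) = Q t - D"
        using Q[OF t] by auto
      also have "real (card (Q t - D)) \<ge> real (card (Q t)) - real (card D)"
        using card_Diff_le by linarith
      finally show ?thesis using cQ[OF t] D by linarith
    qed
    have "(\<Sum>x\<in>X. exp (- (1 / real m) * real (card (B t x - D))))
      = (\<Sum>a\<in>U \<rightarrow>\<^sub>E {..<m}. \<Sum>b\<in>W \<rightarrow>\<^sub>E {..<m}. exp (- real (card (B t (a, b) - D)) / real m))"
      by (simp add: X_def sum.cartesian_product split_def)
    also have "\<dots> = (\<Sum>a\<in>U \<rightarrow>\<^sub>E {..<m}. \<Sum>b\<in>W \<rightarrow>\<^sub>E {..<m}.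
        exp (- (\<Sum>w\<in>W. \<Sum>u\<in>U. if a u = b w then q u w (b w) else 0) / real m))"
      by (intro sum.cong refl) (simp add: eq)
    also have "\<dots> \<le> real m ^ card U * real m ^ card W *
           (exp (- (\<Sum>u\<in>U. \<Sum>i<m. \<Sum>w\<in>W. q u w i) / (4 * real m ^ 3))
            + real m * (1 + 1 / real m) ^ card U / 2 ^ m)"
      by (intro sum_exp_match_le fin m W) (auto simp: q_def)
    also have "\<dots> \<le> real m ^ card U * real m ^ card W * \<rho>"
      unfolding \<rho>_def using qsum m by (intro mult_left_mono add_right_mono) (auto simp: divide_right_mono)
    finally show ?thesis by (simp add: cX power_add)
  qed
  have sub: "B t x \<subseteq> U \<times> W \<times> {..<m}" if "t \<in> T" for t x
    using Q[OF that] by (auto simp: B_def)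
  have "(\<Sum>h\<in>T \<rightarrow>\<^sub>E X. exp (- (1 / real m) * real (card ({} \<union> (\<Union>t\<in>T. B t (h t))))))
      \<le> real (card X) ^ card T * (exp (- (1 / real m) * real (card ({} :: ('u \<times> 'w \<times> nat) set))) * \<rho> ^ card T + exp (- (1 / real m) * L))"
    by (rule sum_exp_card_UN_le[where \<Omega> = "U \<times> W \<times> {..<m}"])
       (use fin finX sub step in \<open>auto simp: \<rho>_def\<close>)
  then have expA: "(\<Sum>h\<in>T \<rightarrow>\<^sub>E X. exp (- real (card (A h)) / real m))
      \<le> real (card X) ^ card T * (\<rho> ^ card T + exp (- L / real m))"
    by (simp add: A_def)
  \<comment> \<open>For fixed \<open>h\<close> the values of \<open>e\<close> at different pairs are
    chosen independently, and \<open>card (C p)\<close> of the \<open>m\<close> values are excluded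
    at \<open>p\<close>. The inequality \<open>1 - y \<le> exp (- y)\<close> makes this the weight
    with rate \<open>1 / m\<close> used above.\<close>
  have avoid: "real (card {e \<in> U \<times> W \<rightarrow>\<^sub>E {..<m}. \<forall>t\<in>T. \<forall>u\<in>U. \<forall>w\<in>W.
             \<not> ((u, w, e (u, w)) \<in> Q t \<and> fst (h t) u = e (u, w) \<and> snd (h t) w = e (u, w))})
      \<le> real m ^ (card U * card W) * exp (- real (card (A h)) / real m)" (is "real (card ?S) \<le> _")
    for h
  proof -
    define C where "C p = {i \<in> {..<m}. (fst p, snd p, i) \<in> A h}" for p
    have "?S = (\<Pi>\<^sub>E p\<in>U \<times> W. {..<m} - C p)"
      by (rule set_eqI) (simp add: PiE_iff A_def B_def C_def, blast)
    then have "real (card ?S) = (\<Prod>p\<in>U \<times> W. real (card ({..<m} - C p)))"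
      using fin by (simp add: card_PiE)
    also have "\<dots> \<le> (\<Prod>p\<in>U \<times> W. real m * exp (- real (card (C p)) / real m))"
    proof (intro prod_mono conjI)
      fix p
      have "real (card ({..<m} - C p)) = real m - real (card (C p))"
      proof -
        have sub: "C p \<subseteq> {..<m}" by (auto simp: C_def)
        then show ?thesis
          using card_Diff_subset[OF finite_subset[OF sub] sub] card_mono[OF _ sub]
          by (simp add: of_nat_diff)
      qed
      also have "\<dots> = real m * (1 + - real (card (C p)) / real m)"
        using m by (simp add: field_simps)
      also have "\<dots> \<le> real m * exp (- real (card (C p)) / real m)"
        by (intro mult_left_mono exp_ge_add_one_self) auto
      finally show "real (card ({..<m} - C p)) \<le> \<dots>" .
    qed auto
    also have "\<dots> = real m ^ (card U * card W) * exp (- real (\<Sum>p\<in>U \<times> W. card (C p)) / real m)"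
      using fin by (simp add: prod.distrib exp_sum [symmetric] sum_negf sum_divide_distrib [symmetric] card_cartesian_product)
    also have "(\<Sum>p\<in>U \<times> W. card (C p)) = card (A h)"
    proof -
      have "A h = (\<lambda>(p, i). (fst p, snd p, i)) ` (SIGMA p:U \<times> W. C p)"
      proof (intro equalityI subsetI)
        fix x assume x: "x \<in> A h"
        then have "x \<in> U \<times> W \<times> {..<m}" unfolding A_def using sub by blast
        with x have "((fst x, fst (snd x)), snd (snd x)) \<in> (SIGMA p:U \<times> W. C p)"
          by (auto simp: C_def)
        then show "x \<in> (\<lambda>(p, i). (fst p, snd p, i)) ` (SIGMA p:U \<times> W. C p)"
          by (rule rev_image_eqI) simp
      qed (auto simp: C_def)
      then have "card (A h) = card (SIGMA p:U \<times> W. C p)"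
        by (simp only:) (rule card_image, auto simp: inj_on_def)
      then show ?thesis
        using fin by (simp add: C_def)
    qed
    finally show ?thesis .
  qed
  have "real (card (SIGMA h:T \<rightarrow>\<^sub>E X. {e \<in> U \<times> W \<rightarrow>\<^sub>E {..<m}. \<forall>t\<in>T. \<forall>u\<in>U. \<forall>w\<in>W.
             \<not> ((u, w, e (u, w)) \<in> Q t \<and> fst (h t) u = e (u, w) \<and> snd (h t) w = e (u, w))}))
     = (\<Sum>h\<in>T \<rightarrow>\<^sub>E X. real (card {e \<in> U \<times> W \<rightarrow>\<^sub>E {..<m}. \<forall>t\<in>T. \<forall>u\<in>U. \<forall>w\<in>W.
             \<not> ((u, w, e (u, w)) \<in> Q t \<and> fst (h t) u = e (u, w) \<and> snd (h t) w = e (u, w))}))"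
    using fin finX finE by (subst card_SigmaI) (auto intro: finite_PiE rev_finite_subset[OF finE])
  also have "\<dots> \<le> (\<Sum>h\<in>T \<rightarrow>\<^sub>E X. real m ^ (card U * card W) * exp (- real (card (A h)) / real m))"
    by (intro sum_mono avoid)
  also have "\<dots> \<le> real m ^ (card U * card W) * (real (card X) ^ card T * (\<rho> ^ card T + exp (- L / real m)))"
    unfolding sum_distrib_left [symmetric] by (intro mult_left_mono expA) auto
  finally show ?thesis
    by (simp add: cX power_add power_mult \<rho>_def)
qed

section \<open>Balance of random partitions into three parts\<close>

text \<open>A random part has expected share one third; the threshold of one tenth is far enough
  below it for failure to be exponentially unlikely in \<open>card U\<close>.\<close>

definition balanced :: "('a \<Rightarrow> nat) \<Rightarrow> 'a set \<Rightarrow> bool" where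
  "balanced \<phi> U \<longleftrightarrow> (\<forall>p<3. card U < 10 * card {x \<in> U. \<phi> x = p})"

lemma card_unbalanced_le:
  fixes A :: "'a set"
  assumes "finite A" "U \<subseteq> A"
  shows "real (card {\<phi> \<in> A \<rightarrow>\<^sub>E {..<3}. \<not> balanced \<phi> U}) \<le> 3 * (9 / 10) ^ card U * 3 ^ card A"
proof -
  \<comment> \<open>Markov's inequality for the weight \<open>y ^ (10 * card {x \<in> U. \<phi> x = p})\<close>; the choice of \<open>y\<close> makes
    \<open>(y ^ 10 + 2) / y \<le> 27 / 10\<close>.\<close>
  define y :: real where "y = 93 / 100"
  have finU: "finite U" using assms finite_subset by blast
  define S where "S = A \<rightarrow>\<^sub>E {..<3::nat}"
  have finS: "finite S" unfolding S_def using assms(1) by (intro finite_PiE) auto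
  have part: "real (card {\<phi> \<in> S. 10 * card {x \<in> U. \<phi> x = p} \<le> card U}) \<le> (9 / 10) ^ card U * 3 ^ card A"
    if p: "p < 3" for p
  proof -
    have "real (card {\<phi> \<in> S. 10 * card {x \<in> U. \<phi> x = p} \<le> card U})
       = (\<Sum>\<phi>\<in>S. if 10 * card {x \<in> U. \<phi> x = p} \<le> card U then 1 else 0)"
      using finS by (simp add: sum.If_cases Int_def)
    also have "\<dots> \<le> (\<Sum>\<phi>\<in>S. (\<Prod>x\<in>A. if x \<in> U \<and> \<phi> x = p then y ^ 10 else 1) / y ^ card U)"
    proof (intro sum_mono)
      fix \<phi>
      have "(\<Prod>x\<in>A. if x \<in> U \<and> \<phi> x = p then y ^ 10 else 1) = y ^ (10 * card {x \<in> U. \<phi> x = p})"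
        using assms by (simp add: prod.If_cases Int_def power_mult) (metis (no_types, lifting) Collect_cong subsetD)
      then show "(if 10 * card {x \<in> U. \<phi> x = p} \<le> card U then 1 else 0)
          \<le> (\<Prod>x\<in>A. if x \<in> U \<and> \<phi> x = p then y ^ 10 else 1) / y ^ card U"
        using power_decreasing[of "10 * card {x \<in> U. \<phi> x = p}" "card U" y] by (simp add: y_def)
    qed
    also have "\<dots> = (\<Prod>x\<in>A. \<Sum>j<3. if x \<in> U \<and> j = p then y ^ 10 else 1) / y ^ card U"
      unfolding S_def sum_divide_distrib [symmetric]
      using assms by (subst prod_sum_PiE) auto
    also have "(\<Prod>x\<in>A. \<Sum>j<3. if x \<in> U \<and> j = p then y ^ 10 else 1) = (\<Prod>x\<in>A. if x \<in> U then y ^ 10 + 2 else 3)"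
    proof (intro prod.cong refl)
      fix x
      have "p = 0 \<or> p = 1 \<or> p = 2" using p by auto
      then show "(\<Sum>j<3. if x \<in> U \<and> j = p then y ^ 10 else 1) = (if x \<in> U then y ^ 10 + 2 else 3)"
        by (auto simp: numeral_3_eq_3)
    qed
    also have "\<dots> = (y ^ 10 + 2) ^ card U * 3 ^ (card A - card U)"
      using assms finU by (simp add: prod.If_cases Int_absorb1 card_Diff_subset Diff_eq [symmetric])
    also have "\<dots> / y ^ card U = ((y ^ 10 + 2) / y) ^ card U * 3 ^ (card A - card U)"
      by (simp add: power_divide)
    also have "\<dots> \<le> (9 / 10 * 3) ^ card U * 3 ^ (card A - card U)"
      by (intro mult_right_mono power_mono) (simp_all add: y_def power_divide)
    also have "\<dots> = (9 / 10) ^ card U * 3 ^ card A"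
      using card_mono[OF assms] unfolding power_mult_distrib mult.assoc power_add [symmetric] by simp
    finally show ?thesis .
  qed
  have "{\<phi> \<in> S. \<not> balanced \<phi> U} = (\<Union>p<3. {\<phi> \<in> S. 10 * card {x \<in> U. \<phi> x = p} \<le> card U})"
    by (auto simp: balanced_def not_less)
  then have "real (card {\<phi> \<in> S. \<not> balanced \<phi> U}) \<le> real (\<Sum>p<3. card {\<phi> \<in> S. 10 * card {x \<in> U. \<phi> x = p} \<le> card U})"
    by (simp only: of_nat_le_iff) (rule card_UN_le, simp)
  also have "\<dots> \<le> (\<Sum>p<3::nat. (9 / 10) ^ card U * 3 ^ card A)"
    unfolding of_nat_sum by (intro sum_mono part) auto
  finally show ?thesis by (simp add: S_def)
qed

text \<open>Markov's inequality for the weight \<open>z\<close> to the number of hits. The weight is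
  a product over \<open>I\<close>, and by the assumption on \<open>z\<close> each coordinate sums to
  at most \<open>2 * card X\<close>. Thus \<open>s\<close> hits have probability at most
  \<open>2 ^ card I / z ^ s\<close>.\<close>

lemma card_many_hits_le:
  fixes z :: real
  assumes "finite I" "finite X" "D \<subseteq> X" and z: "z \<ge> 1" "z * real (card D) \<le> real (card X)"
  shows "real (card {h \<in> I \<rightarrow>\<^sub>E X. s \<le> card {i \<in> I. h i \<in> D}}) * z ^ s \<le> (2 * real (card X)) ^ card I"
proof -
  define S where "S = I \<rightarrow>\<^sub>E X"
  have finS: "finite S" unfolding S_def using assms by (intro finite_PiE) auto
  have "real (card {h \<in> S. s \<le> card {i \<in> I. h i \<in> D}}) * z ^ s
      = (\<Sum>h\<in>S. if s \<le> card {i \<in> I. h i \<in> D} then z ^ s else 0)"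
    using finS by (simp add: sum.If_cases Int_def)
  also have "\<dots> \<le> (\<Sum>h\<in>S. \<Prod>i\<in>I. if h i \<in> D then z else 1)"
    using z assms(1) by (intro sum_mono) (auto simp: prod.If_cases Int_def intro!: power_increasing prod_nonneg)
  also have "\<dots> = (\<Prod>i\<in>I. \<Sum>x\<in>X. if x \<in> D then z else 1)"
    unfolding S_def using assms by (subst prod_sum_PiE) auto
  also have "\<dots> \<le> (\<Prod>i\<in>I. 2 * real (card X))"
  proof (intro prod_mono conjI)
    have "(\<Sum>x\<in>X. if x \<in> D then z else 1) = z * real (card D) + real (card (X - D))"
      using assms by (simp add: sum.If_cases Int_absorb1 Diff_eq [symmetric])
    also have "\<dots> \<le> 2 * real (card X)"
      using z(2) card_mono[of X "X - D"] assms(2) by auto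
    finally show "(\<Sum>x\<in>X. if x \<in> D then z else 1) \<le> 2 * real (card X)" .
  qed (use z in \<open>auto intro!: sum_nonneg\<close>)
  finally show ?thesis by (simp add: S_def)
qed

text \<open>A union bound over the \<open>k\<close>-sets. The partitions for different indices are
  independent, so the hit count applies with \<open>z\<close> the reciprocal of the bound on the
  probability of an unbalanced partition. This makes \<open>s\<close> failures exponentially
  unlikely in \<open>k * s\<close>, enough to beat the number of \<open>k\<close>-sets.\<close>

lemma exists_mostly_balanced:
  fixes A :: "'a set"
  assumes A: "finite A" and k: "3 * (9 / 10 :: real) ^ k \<le> 1"
    and small: "real (card A choose k) * 2 ^ m * (3 * (9 / 10) ^ k) ^ s < 1"
  shows "\<exists>f \<in> {..<m} \<rightarrow>\<^sub>E (A \<rightarrow>\<^sub>E {..<3}). \<forall>U\<in>nsets A k. card {i \<in> {..<m}. \<not> balanced (f i) U} < s"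
proof (rule ccontr)
  assume neg: "\<not> ?thesis"
  define X where "X = A \<rightarrow>\<^sub>E {..<3::nat}"
  define F where "F = {..<m} \<rightarrow>\<^sub>E X"
  define Bad where "Bad U = {f \<in> F. s \<le> card {i \<in> {..<m}. f i \<in> {\<phi> \<in> X. \<not> balanced \<phi> U}}}" for U
  define z :: real where "z = 1 / (3 * (9 / 10) ^ k)"
  have finX: "finite X" unfolding X_def using A by (intro finite_PiE) auto
  have cX: "real (card X) = 3 ^ card A" unfolding X_def using A by (simp add: card_PiE)
  have finF: "finite F" unfolding F_def using finX by (intro finite_PiE) auto
  have z1: "z \<ge> 1" using k by (simp add: z_def)
  have "F \<subseteq> (\<Union>U\<in>nsets A k. Bad U)"
  proof
    fix f assume f: "f \<in> F"
    then obtain U where U: "U \<in> nsets A k" "s \<le> card {i \<in> {..<m}. \<not> balanced (f i) U}"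
      using neg unfolding F_def X_def by (meson not_less)
    moreover have "{i \<in> {..<m}. \<not> balanced (f i) U} = {i \<in> {..<m}. f i \<in> {\<phi> \<in> X. \<not> balanced \<phi> U}}"
      using f by (auto simp: F_def)
    ultimately show "f \<in> (\<Union>U\<in>nsets A k. Bad U)"
      using f by (auto simp: Bad_def)
  qed
  then have "card F \<le> card (\<Union>U\<in>nsets A k. Bad U)"
    using finF A by (intro card_mono) (auto simp: Bad_def finite_imp_finite_nsets)
  also have "\<dots> \<le> (\<Sum>U\<in>nsets A k. card (Bad U))"
    using A by (intro card_UN_le finite_imp_finite_nsets)
  finally have "real (card F) \<le> (\<Sum>U\<in>nsets A k. real (card (Bad U)))"
    by (simp flip: of_nat_sum)
  also have "\<dots> \<le> (\<Sum>U\<in>nsets A k. (2 * real (card X)) ^ m / z ^ s)"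
  proof (intro sum_mono)
    fix U assume "U \<in> nsets A k"
    then have U: "U \<subseteq> A" "card U = k" by (auto simp: nsets_def)
    have "z * real (card {\<phi> \<in> X. \<not> balanced \<phi> U}) \<le> z * (3 * (9 / 10) ^ k * 3 ^ card A)"
      using card_unbalanced_le[OF A U(1)] z1 unfolding X_def U(2) by (intro mult_left_mono) auto
    also have "\<dots> = real (card X)" by (simp add: z_def cX)
    finally have "real (card (Bad U)) * z ^ s \<le> (2 * real (card X)) ^ card {..<m}"
      unfolding Bad_def F_def by (intro card_many_hits_le finX z1) auto
    then show "real (card (Bad U)) \<le> (2 * real (card X)) ^ m / z ^ s"
      using z1 by (simp add: field_simps)
  qed
  also have "\<dots> = real (card A choose k) * 2 ^ m * (3 * (9 / 10) ^ k) ^ s * real (card X) ^ m"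
    by (simp add: z_def power_mult_distrib power_divide)
  also have "\<dots> < 1 * real (card X) ^ m"
    using small cX by (intro mult_strict_right_mono) auto
  finally show False
    by (simp add: F_def card_PiE)
qed

section \<open>Red triples, and colourings in which any three disjoint \<open>k\<close>-sets span
  one\<close>

definition red :: "(nat \<Rightarrow> 'a \<Rightarrow> nat) \<Rightarrow> ('a set \<Rightarrow> nat) \<Rightarrow> nat \<Rightarrow> 'a set \<Rightarrow> bool" where
  "red f g m e \<longleftrightarrow> (\<exists>i<m. (\<forall>p\<in>nsets e 2. g p = i) \<and> inj_on (f i) e)"

lemma nsets_triple_2:
  assumes "x \<noteq> y" "x \<noteq> z" "y \<noteq> z"
  shows "nsets {x, y, z} 2 = {{x, y}, {x, z}, {y, z}}"
  using assms by (auto simp: nsets_2_eq)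

text \<open>At most \<open>2 * s\<close> of the \<open>4 * s\<close> indices are unbalanced on
  \<open>U\<close> or on \<open>W\<close>. For each of the others, the two parts avoiding
  \<open>t\<close> contain more than \<open>k / 10\<close> vertices of \<open>U\<close> and of
  \<open>W\<close> respectively, which gives \<open>(k / 10)\<^sup>2\<close> pairs
  \<open>(u, w)\<close>.\<close>

lemma card_transversal_ge:
  fixes f :: "nat \<Rightarrow> 'a \<Rightarrow> nat" and s k :: nat
  assumes fin: "finite U" "finite W" and card: "card U = k" "card W = k"
    and t: "\<And>i. i < 4 * s \<Longrightarrow> f i t < 3"
    and U: "card {i \<in> {..<4 * s}. \<not> balanced (f i) U} \<le> s"
    and W: "card {i \<in> {..<4 * s}. \<not> balanced (f i) W} \<le> s"
  shows "real s * (real k)\<^sup>2 / 50 \<le>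
    real (card {(u, w, i) \<in> U \<times> W \<times> {..<4 * s}. f i t \<noteq> f i u \<and> f i t \<noteq> f i w \<and> f i u \<noteq> f i w})"
    (is "_ \<le> real (card ?Q)")
proof -
  define R where "R i = {(u, w) \<in> U \<times> W. f i t \<noteq> f i u \<and> f i t \<noteq> f i w \<and> f i u \<noteq> f i w}" for i
  define G where "G = {i \<in> {..<4 * s}. balanced (f i) U \<and> balanced (f i) W}"
  have finR: "finite (R i)" for i
    unfolding R_def using fin by (auto intro: finite_subset[of _ "U \<times> W"])
  have "?Q = (\<lambda>(i, u, w). (u, w, i)) ` (SIGMA i:{..<4 * s}. R i)"
  proof (intro equalityI subsetI)
    fix x assume x: "x \<in> ?Q"
    then have "(snd (snd x), fst x, fst (snd x)) \<in> (SIGMA i:{..<4 * s}. R i)"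
      by (auto simp: R_def)
    then show "x \<in> (\<lambda>(i, u, w). (u, w, i)) ` (SIGMA i:{..<4 * s}. R i)"
      by (rule rev_image_eqI) simp
  qed (auto simp: R_def)
  then have "card ?Q = card (SIGMA i:{..<4 * s}. R i)"
    by (simp only:) (rule card_image, auto simp: inj_on_def)
  also have "\<dots> = (\<Sum>i<4 * s. card (R i))"
    using finR by simp
  finally have cQ: "real (card ?Q) = (\<Sum>i<4 * s. real (card (R i)))"
    by simp
  have G: "2 * s \<le> card G"
  proof -
    define H where "H = {i \<in> {..<4 * s}. \<not> balanced (f i) U} \<union> {i \<in> {..<4 * s}. \<not> balanced (f i) W}"
    have "{..<4 * s} = G \<union> H"
      by (auto simp: G_def H_def)
    then have "card {..<4 * s} = card (G \<union> H)"
      by (rule arg_cong)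
    then have "4 * s = card (G \<union> H)"
      by (simp only: card_lessThan)
    also have "\<dots> \<le> card G + card H"
      by (rule card_Un_le)
    also have "\<dots> \<le> card G + (card {i \<in> {..<4 * s}. \<not> balanced (f i) U} + card {i \<in> {..<4 * s}. \<not> balanced (f i) W})"
      unfolding H_def by (intro add_left_mono card_Un_le)
    finally show ?thesis using U W by linarith
  qed
  have R: "(real k / 10)\<^sup>2 \<le> real (card (R i))" if i: "i \<in> G" for i
  proof -
    \<comment> \<open>\<open>p\<close> and \<open>q\<close> are the two parts other than that of
      \<open>t\<close>. Counting only the pairs with \<open>u\<close> in part \<open>p\<close> and
      \<open>w\<close> in part \<open>q\<close> suffices.\<close>
    define p where "p = (f i t + 1) mod 3"
    define q where "q = (f i t + 2) mod 3"
    have "f i t < 3" using t i by (auto simp: G_def)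
    then have "f i t = 0 \<or> f i t = 1 \<or> f i t = 2" by auto
    then have pq: "p < 3" "q < 3" "p \<noteq> q" "f i t \<noteq> p" "f i t \<noteq> q"
      by (auto simp: p_def q_def)
    have "k < 10 * card {u \<in> U. f i u = p}" "k < 10 * card {w \<in> W. f i w = q}"
      using i pq card by (auto simp: G_def balanced_def)
    then have "real k / 10 \<le> real (card {u \<in> U. f i u = p})" "real k / 10 \<le> real (card {w \<in> W. f i w = q})"
      by linarith+
    then have "(real k / 10)\<^sup>2 \<le> real (card {u \<in> U. f i u = p}) * real (card {w \<in> W. f i w = q})"
      unfolding power2_eq_square by (intro mult_mono) auto
    also have "\<dots> = real (card ({u \<in> U. f i u = p} \<times> {w \<in> W. f i w = q}))"
      by (simp add: card_cartesian_product)
    also have "\<dots> \<le> real (card (R i))"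
      using finR pq by (intro of_nat_mono card_mono) (auto simp: R_def)
    finally show ?thesis .
  qed
  have "real s * (real k)\<^sup>2 / 50 = real (2 * s) * (real k / 10)\<^sup>2"
    by (simp add: power2_eq_square)
  also have "\<dots> \<le> real (card G) * (real k / 10)\<^sup>2"
    using G by (intro mult_right_mono of_nat_mono) auto
  also have "\<dots> \<le> (\<Sum>i\<in>G. real (card (R i)))"
    using sum_mono[of G "\<lambda>_. (real k / 10)\<^sup>2" "\<lambda>i. real (card (R i))"] R by simp
  also have "\<dots> \<le> (\<Sum>i<4 * s. real (card (R i)))"
    by (intro sum_mono2) (auto simp: G_def)
  finally show ?thesis unfolding cQ .
qed

text \<open>Whether a triple of \<open>T\<close>, \<open>U\<close>, \<open>W\<close> is red depends
  on \<open>g\<close> only through the cross pairs. The colourings of these are counted by the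
  transversal estimate, while all other pairs are free and contribute a power of
  \<open>m\<close>.\<close>

lemma card_no_red_le:
  fixes A :: "'a set" and s k m :: nat
  assumes A: "finite A" and sub: "T \<subseteq> A" "U \<subseteq> A" "W \<subseteq> A"
    and disj: "T \<inter> U = {}" "T \<inter> W = {}" "U \<inter> W = {}"
    and card: "card T = k" "card U = k" "card W = k"
    and m: "m = 4 * s" "s > 0" and k: "k \<le> 2 * m\<^sup>2"
    and f: "f \<in> {..<m} \<rightarrow>\<^sub>E (A \<rightarrow>\<^sub>E {..<3})"
    and U: "card {i \<in> {..<m}. \<not> balanced (f i) U} < s"
    and W: "card {i \<in> {..<m}. \<not> balanced (f i) W} < s"
  defines "L \<equiv> real s * (real k)\<^sup>2 / 100"
  shows "real (card {g \<in> nsets A 2 \<rightarrow>\<^sub>E {..<m}. \<forall>t\<in>T. \<forall>u\<in>U. \<forall>w\<in>W. \<not> red f g m {t, u, w}})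
    \<le> real m ^ card (nsets A 2) *
       ((exp (- L / (4 * real m ^ 3)) + real m * (1 + 1 / real m) ^ k / 2 ^ m) ^ k + exp (- L / real m))"
proof -
  define P where "P = nsets A 2"
  define C where "C = (\<lambda>(x, y). {x, y}) ` (T \<times> U \<union> T \<times> W \<union> U \<times> W)"
  define Q where "Q t = {(u, w, i) \<in> U \<times> W \<times> {..<m}. f i t \<noteq> f i u \<and> f i t \<noteq> f i w \<and> f i u \<noteq> f i w}" for t
  define X where "X = (U \<rightarrow>\<^sub>E {..<m}) \<times> (W \<rightarrow>\<^sub>E {..<m})"
  define Z where "Z = (SIGMA h:T \<rightarrow>\<^sub>E X. {e \<in> U \<times> W \<rightarrow>\<^sub>E {..<m}. \<forall>t\<in>T. \<forall>u\<in>U. \<forall>w\<in>W.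
             \<not> ((u, w, e (u, w)) \<in> Q t \<and> fst (h t) u = e (u, w) \<and> snd (h t) w = e (u, w))})"
  define \<rho> where "\<rho> = exp (- L / (4 * real m ^ 3)) + real m * (1 + 1 / real m) ^ k / 2 ^ m"
  define S where "S = {g \<in> P \<rightarrow>\<^sub>E {..<m}. \<forall>t\<in>T. \<forall>u\<in>U. \<forall>w\<in>W. \<not> red f g m {t, u, w}}"
  \<comment> \<open>\<open>\<Phi>\<close> cuts \<open>g\<close> into the pairs at each
    \<open>t\<close>, the pairs between \<open>U\<close> and \<open>W\<close>, and the pairs outside
    \<open>C\<close>. These pieces determine \<open>g\<close>, so counting their combinations bounds
    the number of colourings.\<close>
  define \<Phi> where "\<Phi> g = (((\<lambda>t\<in>T. (\<lambda>u\<in>U. g {t, u}, \<lambda>w\<in>W. g {t, w})), (\<lambda>q\<in>U \<times> W. g {fst q, snd q})),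
                            restrict g (P - C))" for g :: "'a set \<Rightarrow> nat"
  have fin: "finite T" "finite U" "finite W"
    using sub A finite_subset by blast+
  have finP: "finite P" unfolding P_def using A by (rule finite_imp_finite_nsets)
  have finX: "finite X"
    unfolding X_def using fin by (intro finite_cartesian_product finite_PiE) auto
  have finZ: "finite Z"
  proof (rule finite_subset)
    show "Z \<subseteq> (T \<rightarrow>\<^sub>E X) \<times> (U \<times> W \<rightarrow>\<^sub>E {..<m})" by (auto simp: Z_def)
  qed (use fin finX in \<open>auto intro!: finite_cartesian_product finite_PiE\<close>)
  have pairs: "{x, y} \<in> P" if "x \<in> A" "y \<in> A" "x \<noteq> y" for x y
    using that by (auto simp: P_def)
  have CP: "C \<subseteq> P"
    using sub disj by (auto simp: C_def intro!: pairs)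
  have cC: "card C = 3 * k * k"
  proof -
    have "card C = card (T \<times> U \<union> T \<times> W \<union> U \<times> W)"
      unfolding C_def using disj by (intro card_image) (auto simp: inj_on_def doubleton_eq_iff)
    also have "\<dots> = card (T \<times> U \<union> T \<times> W) + card (U \<times> W)"
      using fin disj by (intro card_Un_disjoint) auto
    also have "card (T \<times> U \<union> T \<times> W) = card (T \<times> U) + card (T \<times> W)"
      using fin disj by (intro card_Un_disjoint) auto
    finally show ?thesis by (simp add: card_cartesian_product card)
  qed
  have "inj_on \<Phi> S"
  proof (rule inj_onI)
    fix g g' assume g: "g \<in> S" "g' \<in> S" and eq: "\<Phi> g = \<Phi> g'"
    have tu: "g {t, u} = g' {t, u}" if "t \<in> T" "u \<in> U" for t u
    proof -
      have "fst (fst (fst (\<Phi> g)) t) u = fst (fst (fst (\<Phi> g')) t) u" using eq by simp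
      then show ?thesis using that by (simp add: \<Phi>_def)
    qed
    have tw: "g {t, w} = g' {t, w}" if "t \<in> T" "w \<in> W" for t w
    proof -
      have "snd (fst (fst (\<Phi> g)) t) w = snd (fst (fst (\<Phi> g')) t) w" using eq by simp
      then show ?thesis using that by (simp add: \<Phi>_def)
    qed
    have uw: "g {u, w} = g' {u, w}" if "u \<in> U" "w \<in> W" for u w
    proof -
      have "snd (fst (\<Phi> g)) (u, w) = snd (fst (\<Phi> g')) (u, w)" using eq by simp
      then show ?thesis using that by (simp add: \<Phi>_def)
    qed
    have rest: "g p = g' p" if "p \<in> P - C" for p
    proof -
      have "snd (\<Phi> g) p = snd (\<Phi> g') p" using eq by simp
      then show ?thesis using that by (simp add: \<Phi>_def)
    qed
    show "g = g'"
    proof (rule PiE_ext)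
      show "g \<in> P \<rightarrow>\<^sub>E {..<m}" "g' \<in> P \<rightarrow>\<^sub>E {..<m}" using g by (auto simp: S_def)
      fix p assume "p \<in> P"
      then show "g p = g' p"
        using tu tw uw rest by (cases "p \<in> C") (auto simp: C_def)
    qed
  qed
  moreover have "\<Phi> ` S \<subseteq> Z \<times> (P - C \<rightarrow>\<^sub>E {..<m})"
  proof
    fix y assume "y \<in> \<Phi> ` S"
    then obtain g where g: "g \<in> S" and y: "y = \<Phi> g" by auto
    have gP: "g p < m" if "p \<in> P" for p
      using g that by (auto simp: S_def)
    have gC: "g {x, y} < m" if "(x, y) \<in> T \<times> U \<union> T \<times> W \<union> U \<times> W" for x y
      using that CP by (intro gP) (auto simp: C_def)
    have no: "\<not> ((u, w, g {u, w}) \<in> Q t \<and> g {t, u} = g {u, w} \<and> g {t, w} = g {u, w})"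
      if tuw: "t \<in> T" "u \<in> U" "w \<in> W" for t u w
    proof
      assume *: "(u, w, g {u, w}) \<in> Q t \<and> g {t, u} = g {u, w} \<and> g {t, w} = g {u, w}"
      have "t \<noteq> u" "t \<noteq> w" "u \<noteq> w" using tuw disj by auto
      then have "red f g m {t, u, w}"
        unfolding red_def nsets_triple_2[OF \<open>t \<noteq> u\<close> \<open>t \<noteq> w\<close> \<open>u \<noteq> w\<close>]
        using * by (intro exI[of _ "g {u, w}"]) (auto simp: Q_def)
      with g tuw show False by (auto simp: S_def)
    qed
    show "y \<in> Z \<times> (P - C \<rightarrow>\<^sub>E {..<m})"
      unfolding y \<Phi>_def Z_def X_def using gP gC no by auto
  qed
  ultimately have "card S \<le> card (Z \<times> (P - C \<rightarrow>\<^sub>E {..<m}))"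
    using finZ finP by (intro card_inj_on_le) (auto intro!: finite_cartesian_product finite_PiE)
  also have "\<dots> = card Z * m ^ card (P - C)"
    using finP by (simp add: card_cartesian_product card_PiE)
  finally have "real (card S) \<le> real (card Z) * real m ^ card (P - C)"
    by (simp flip: of_nat_mult of_nat_power)
  also have "\<dots> \<le> real m ^ (card U * card W + (card U + card W) * card T) *
           ((exp (- L / (4 * real m ^ 3)) + real m * (1 + 1 / real m) ^ card U / 2 ^ m) ^ card T
            + exp (- L / real m)) * real m ^ card (P - C)"
    unfolding Z_def X_def
  proof (intro mult_right_mono card_transversal_avoid_le fin)
    show "0 < m" "card W \<le> 2 * m\<^sup>2" using m k card by auto
    show "Q t \<subseteq> U \<times> W \<times> {..<m}" for t by (auto simp: Q_def)
    \<comment> \<open>\<open>L\<close> was chosen as half of the lower bound on the number of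
      transversal pairs with index.\<close>
    show "2 * L \<le> real (card (Q t))" if "t \<in> T" for t
    proof -
      have "f i t < 3" if "i < 4 * s" for i
        using f that m \<open>t \<in> T\<close> sub by (auto simp: PiE_iff Pi_iff)
      then have "real s * (real k)\<^sup>2 / 50 \<le> real (card (Q t))"
        unfolding Q_def m(1) using U W m by (intro card_transversal_ge fin card) auto
      then show ?thesis by (simp add: L_def)
    qed
  qed auto
  also have "\<dots> = real m ^ (3 * k * k + card (P - C)) * (\<rho> ^ k + exp (- L / real m))"
  proof -
    have "k * k + (k + k) * k = 3 * k * k" by (simp add: algebra_simps)
    then have e: "real m ^ (k * k + (k + k) * k) = real m ^ (3 * k * k)" by (rule arg_cong)
    show ?thesis unfolding card \<rho>_def e by (simp only: power_add mult_ac)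
  qed
  also have "3 * k * k + card (P - C) = card P"
    using card_mono[OF finP CP] finP finite_subset[OF CP finP] by (simp add: card_Diff_subset CP cC)
  finally show ?thesis
    by (simp add: S_def P_def \<rho>_def)
qed

text \<open>The partitions \<open>f\<close> are fixed first, mostly balanced on every
  \<open>k\<close>-set. A second union bound, over at most \<open>(card A choose k) ^ 3\<close>
  triples of disjoint sets, then finds \<open>g\<close>.\<close>

lemma exists_good_colouring:
  fixes A :: "'a set" and s k m :: nat
  assumes A: "finite A" and m: "m = 4 * s" "s > 0" and k: "k \<le> 2 * m\<^sup>2"
    and k3: "3 * (9 / 10 :: real) ^ k \<le> 1"
    and small_f: "real (card A choose k) * 2 ^ m * (3 * (9 / 10) ^ k) ^ s < 1"
  defines "L \<equiv> real s * (real k)\<^sup>2 / 100"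
  assumes small_g: "real (card A choose k) ^ 3 *
      ((exp (- L / (4 * real m ^ 3)) + real m * (1 + 1 / real m) ^ k / 2 ^ m) ^ k + exp (- L / real m)) < 1"
  obtains f g where "f \<in> {..<m} \<rightarrow>\<^sub>E (A \<rightarrow>\<^sub>E {..<3})"
    and "\<And>T U W. \<lbrakk>T \<in> nsets A k; U \<in> nsets A k; W \<in> nsets A k; T \<inter> U = {}; T \<inter> W = {}; U \<inter> W = {}\<rbrakk>
           \<Longrightarrow> \<exists>t\<in>T. \<exists>u\<in>U. \<exists>w\<in>W. red f g m {t, u, w}"
proof -
  obtain f where f: "f \<in> {..<m} \<rightarrow>\<^sub>E (A \<rightarrow>\<^sub>E {..<3})"
    and bal: "\<And>U. U \<in> nsets A k \<Longrightarrow> card {i \<in> {..<m}. \<not> balanced (f i) U} < s"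
    using exists_mostly_balanced[OF A k3 small_f] by blast
  define F where "F = nsets A 2 \<rightarrow>\<^sub>E {..<m}"
  define Bad where "Bad = (\<lambda>(T, U, W). {g \<in> F. \<forall>t\<in>T. \<forall>u\<in>U. \<forall>w\<in>W. \<not> red f g m {t, u, w}})"
  define J where "J = {(T, U, W). T \<in> nsets A k \<and> U \<in> nsets A k \<and> W \<in> nsets A k \<and>
      T \<inter> U = {} \<and> T \<inter> W = {} \<and> U \<inter> W = {}}"
  define \<epsilon> where "\<epsilon> = (exp (- L / (4 * real m ^ 3)) + real m * (1 + 1 / real m) ^ k / 2 ^ m) ^ k + exp (- L / real m)"
  have \<epsilon>0: "\<epsilon> \<ge> 0" by (simp add: \<epsilon>_def)
  have finN: "finite (nsets A j)" for j using A by (rule finite_imp_finite_nsets)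
  have finF: "finite F" unfolding F_def using finN by (intro finite_PiE) auto
  have J: "J \<subseteq> nsets A k \<times> nsets A k \<times> nsets A k" by (auto simp: J_def)
  have finJ: "finite J" using J by (rule finite_subset) (auto intro: finN)
  have "card J \<le> card (nsets A k \<times> nsets A k \<times> nsets A k)"
    using J by (rule card_mono[rotated]) (auto intro: finN)
  then have cJ: "card J \<le> (card A choose k) ^ 3"
    by (simp add: card_cartesian_product power3_eq_cube mult.assoc)
  have cF: "real (card F) = real m ^ card (nsets A 2)"
    unfolding F_def using finN by (simp add: card_PiE)
  have "\<exists>g\<in>F. \<forall>j\<in>J. g \<notin> Bad j"
  proof (rule ccontr)
    assume "\<not> ?thesis"
    then have "F \<subseteq> (\<Union>j\<in>J. Bad j)" by auto
    then have "card F \<le> card (\<Union>j\<in>J. Bad j)"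
      using finF finJ by (intro card_mono) (auto simp: Bad_def)
    also have "\<dots> \<le> (\<Sum>j\<in>J. card (Bad j))"
      using finJ by (rule card_UN_le)
    finally have "real (card F) \<le> (\<Sum>j\<in>J. real (card (Bad j)))"
      by (simp flip: of_nat_sum)
    also have "\<dots> \<le> (\<Sum>j\<in>J. real (card F) * \<epsilon>)"
    proof (intro sum_mono)
      fix j assume "j \<in> J"
      then obtain T U W where j: "j = (T, U, W)" and TUW: "T \<in> nsets A k" "U \<in> nsets A k" "W \<in> nsets A k"
        and disj: "T \<inter> U = {}" "T \<inter> W = {}" "U \<inter> W = {}"
        by (auto simp: J_def)
      have sub: "T \<subseteq> A" "U \<subseteq> A" "W \<subseteq> A" "card T = k" "card U = k" "card W = k"
        using TUW by (auto simp: nsets_def)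
      have "real (card (Bad j)) \<le> real m ^ card (nsets A 2) * \<epsilon>"
        unfolding j Bad_def \<epsilon>_def L_def prod.case F_def
        by (rule card_no_red_le) (use A sub disj m k f bal TUW in auto)
      then show "real (card (Bad j)) \<le> real (card F) * \<epsilon>"
        by (simp only: cF)
    qed
    also have "\<dots> = real (card J) * \<epsilon> * real (card F)"
      by simp
    also have "\<dots> \<le> real ((card A choose k) ^ 3) * \<epsilon> * real (card F)"
      using cJ \<epsilon>0 by (intro mult_right_mono of_nat_mono) auto
    also have "\<dots> < 1 * real (card F)"
      using small_g m cF by (intro mult_strict_right_mono) (auto simp: \<epsilon>_def)
    finally show False by simp
  qed
  then obtain g where g: "g \<in> F" "\<And>j. j \<in> J \<Longrightarrow> g \<notin> Bad j" by blast
  show ?thesis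
  proof (rule that[OF f])
    fix T U W
    assume "T \<in> nsets A k" "U \<in> nsets A k" "W \<in> nsets A k" "T \<inter> U = {}" "T \<inter> W = {}" "U \<inter> W = {}"
    then have "(T, U, W) \<in> J" by (simp add: J_def)
    from g(2)[OF this] g(1) show "\<exists>t\<in>T. \<exists>u\<in>U. \<exists>w\<in>W. red f g m {t, u, w}"
      by (auto simp: Bad_def)
  qed
qed

section \<open>Red copies of \<open>H\<close> and the failure of the Ramsey property\<close>

text \<open>A tight path carries the index of one edge to all others, so a single partition
  \<open>f i\<close> separates the vertices of every edge. Pulling it back along
  \<open>\<phi>\<close> gives the three parts.\<close>

lemma tripartite_of_red_copy:
  assumes H: "three_graph V E" "tightly_connected E"
    and \<phi>: "inj_on \<phi> V" "\<phi> ` V \<subseteq> A" and red: "\<And>e. e \<in> E \<Longrightarrow> red f g m (\<phi> ` e)"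
    and f: "f \<in> {..<m} \<rightarrow>\<^sub>E (A \<rightarrow>\<^sub>E {..<3})"
  shows "tripartite V E"
proof (cases "E = {}")
  case True
  then show ?thesis
    unfolding tripartite_def by (intro exI[of _ V] exI[of _ "{}"]) auto
next
  case False
  then obtain e0 where e0: "e0 \<in> E" by auto
  have E3: "e \<subseteq> V" "finite e" "card e = 3" if "e \<in> E" for e
    using H(1) that by (auto simp: three_graph_def nsets_def)
  define col where "col i e \<longleftrightarrow> i < m \<and> (\<forall>p\<in>nsets (\<phi> ` e) 2. g p = i) \<and> inj_on (f i) (\<phi> ` e)" for i e
  have ex: "\<exists>i. col i e" if "e \<in> E" for e
    using red[OF that] by (auto simp: red_def col_def)
  \<comment> \<open>Two edges sharing a pair of vertices get the same index, namely the value of \<open>g\<close> at that pair.\<close>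
  have step: "i = j" if e: "e \<in> E" "e' \<in> E" "card (e \<inter> e') = 2" and ij: "col i e" "col j e'" for e e' i j
  proof -
    have "inj_on \<phi> (e \<inter> e')"
      using \<phi>(1) E3(1)[OF e(1)] by (auto intro: inj_on_subset)
    then have "\<phi> ` (e \<inter> e') \<in> nsets (\<phi> ` e) 2" "\<phi> ` (e \<inter> e') \<in> nsets (\<phi> ` e') 2"
      using e E3[OF e(1)] by (auto simp: nsets_def card_image)
    with ij show ?thesis by (auto simp: col_def)
  qed
  obtain i where i: "col i e0" using ex[OF e0] by blast
  have all: "col i e" if e: "e \<in> E" for e
  proof -
    obtain t and s :: "nat \<Rightarrow> 'a set" where s: "s 0 = e0" "s t = e" "\<forall>j\<le>t. s j \<in> E"
      "\<forall>j\<in>{1..t}. card (s (j - 1) \<inter> s j) = 2"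
      using bspec[OF bspec[OF H(2)[unfolded tightly_connected_def] e0] e]
      by (elim exE conjE) (rule that; assumption)
    have "col i (s j)" if "j \<le> t" for j
      using that
    proof (induction j)
      case 0
      then show ?case using s i by simp
    next
      case (Suc j)
      have "j \<le> t" "Suc j \<in> {1..t}" using Suc.prems by auto
      have sj: "col i (s j)" using Suc.IH \<open>j \<le> t\<close> .
      have sE: "s j \<in> E" "s (Suc j) \<in> E" using s(3) Suc.prems \<open>j \<le> t\<close> by blast+
      have "card (s (Suc j - 1) \<inter> s (Suc j)) = 2" using s(4) \<open>Suc j \<in> {1..t}\<close> by blast
      then have sc: "card (s j \<inter> s (Suc j)) = 2" by simp
      obtain l where l: "col l (s (Suc j))" using ex[OF sE(2)] by blast
      with step[OF sE sc sj l] show ?case by simp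
    qed
    then show ?thesis using s(2) by auto
  qed
  have im: "i < m" using i by (simp add: col_def)
  define part where "part p = {v \<in> V. f i (\<phi> v) = p}" for p
  have f3: "f i (\<phi> v) < 3" if "v \<in> V" for v
    using f im \<phi>(2) that by (auto simp: PiE_iff Pi_iff image_subset_iff)
  have cap: "card (e \<inter> part p) = 1" if e: "e \<in> E" and p: "p < 3" for e p
  proof -
    have "inj_on \<phi> e" using \<phi>(1) E3(1)[OF e] by (rule inj_on_subset)
    then have inj: "inj_on (\<lambda>v. f i (\<phi> v)) e"
      using all[OF e] comp_inj_on[of \<phi> e "f i"] by (simp add: col_def comp_def)
    \<comment> \<open>Three distinct values below 3 exhaust all of them, so the edge meets each
      part, and by injectivity only once.\<close>
    have "(\<lambda>v. f i (\<phi> v)) ` e = {..<3}"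
    proof (rule card_subset_eq)
      show "(\<lambda>v. f i (\<phi> v)) ` e \<subseteq> {..<3}"
        using f3 E3(1)[OF e] by blast
      show "card ((\<lambda>v. f i (\<phi> v)) ` e) = card {..<3::nat}"
        using inj E3(3)[OF e] by (simp add: card_image)
    qed simp
    with p have "p \<in> (\<lambda>v. f i (\<phi> v)) ` e" by simp
    then obtain v where v: "v \<in> e" "f i (\<phi> v) = p" by blast
    then have "e \<inter> part p = {v}"
      using inj E3(1)[OF e] by (auto simp: part_def inj_on_def)
    then show ?thesis by simp
  qed
  have "part 0 \<union> part 1 \<union> part 2 = V"
  proof (intro equalityI subsetI)
    fix v assume v: "v \<in> V"
    have "f i (\<phi> v) = 0 \<or> f i (\<phi> v) = 1 \<or> f i (\<phi> v) = 2"
      using f3[OF v] by auto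
    with v show "v \<in> part 0 \<union> part 1 \<union> part 2" by (auto simp: part_def)
  qed (auto simp: part_def)
  then show ?thesis
    unfolding tripartite_def using cap
    by (intro exI[of _ "part 0"] exI[of _ "part 1"] exI[of _ "part 2"]) (auto simp: part_def)
qed

text \<open>A red copy of \<open>H\<close> would make it tripartite, and a blue clique on at least
  \<open>3 * k\<close> vertices would contain three disjoint \<open>k\<close>-sets without a red
  transversal triple. The two smallness assumptions feed the union bounds for \<open>f\<close> and
  for \<open>g\<close>.\<close>

lemma not_ramsey_prop:
  fixes V :: "'a set" and E :: "'a set set" and s k m n N :: nat
  assumes H: "three_graph V E" "tightly_connected E" "\<not> tripartite V E"
    and n: "3 * k \<le> n"
    and m: "m = 4 * s" "s > 0" and k: "k \<le> 2 * m\<^sup>2"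
    and k3: "3 * (9 / 10 :: real) ^ k \<le> 1"
    and small_f: "real (N choose k) * 2 ^ m * (3 * (9 / 10) ^ k) ^ s < 1"
  defines "L \<equiv> real s * (real k)\<^sup>2 / 100"
  assumes small_g: "real (N choose k) ^ 3 *
      ((exp (- L / (4 * real m ^ 3)) + real m * (1 + 1 / real m) ^ k / 2 ^ m) ^ k + exp (- L / real m)) < 1"
  shows "\<not> ramsey_prop V E n N"
proof
  assume R: "ramsey_prop V E n N"
  obtain f g where f: "f \<in> {..<m} \<rightarrow>\<^sub>E ({..<N} \<rightarrow>\<^sub>E {..<3})"
    and fg: "\<And>T U W. \<lbrakk>T \<in> nsets {..<N} k; U \<in> nsets {..<N} k; W \<in> nsets {..<N} k; T \<inter> U = {}; T \<inter> W = {}; U \<inter> W = {}\<rbrakk>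
           \<Longrightarrow> \<exists>t\<in>T. \<exists>u\<in>U. \<exists>w\<in>W. red f g m {t, u, w}"
    using exists_good_colouring[of "{..<N}" m s k] m k k3 small_f small_g unfolding L_def card_lessThan
    by blast
  define \<chi> where "\<chi> e = (if red f g m e then Red else Blue)" for e
  have "contains_copy {..<N} (colour_class N \<chi> Red) V E \<or>
          contains_copy {..<N} (colour_class N \<chi> Blue) {..<n} (nsets {..<n} 3)"
    using R unfolding ramsey_prop_def by blast
  then show False
  proof
    assume "contains_copy {..<N} (colour_class N \<chi> Red) V E"
    then obtain \<phi> where \<phi>: "inj_on \<phi> V" "\<phi> ` V \<subseteq> {..<N}" "\<forall>e\<in>E. \<phi> ` e \<in> colour_class N \<chi> Red"
      unfolding contains_copy_def by blast
    have "red f g m (\<phi> ` e)" if "e \<in> E" for e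
      using \<phi>(3) that by (auto simp: colour_class_def \<chi>_def split: if_splits)
    with tripartite_of_red_copy[OF H(1,2) \<phi>(1,2) _ f] H(3) show False by blast
  next
    assume "contains_copy {..<N} (colour_class N \<chi> Blue) {..<n} (nsets {..<n} 3)"
    then obtain \<phi> where \<phi>: "inj_on \<phi> {..<n}" "\<phi> ` {..<n} \<subseteq> {..<N}"
      "\<forall>e\<in>nsets {..<n} 3. \<phi> ` e \<in> colour_class N \<chi> Blue"
      unfolding contains_copy_def by blast
    \<comment> \<open>The clique is cut into three consecutive blocks of \<open>k\<close>
      vertices.\<close>
    have sub: "{..<k} \<subseteq> {..<n}" "{k..<2 * k} \<subseteq> {..<n}" "{2 * k..<3 * k} \<subseteq> {..<n}"
      using n by auto
    have im: "\<phi> ` X \<in> nsets {..<N} k" if "X \<subseteq> {..<n}" "card X = k" "finite X" for X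
      using \<phi>(1,2) that by (auto simp: nsets_def card_image inj_on_subset)
    have disj: "\<phi> ` X \<inter> \<phi> ` Y = {}" if "X \<subseteq> {..<n}" "Y \<subseteq> {..<n}" "X \<inter> Y = {}" for X Y
      using inj_on_image_Int[OF \<phi>(1) that(1,2)] that(3) by simp
    have "\<exists>t\<in>\<phi> ` {..<k}. \<exists>u\<in>\<phi> ` {k..<2 * k}. \<exists>w\<in>\<phi> ` {2 * k..<3 * k}. red f g m {t, u, w}"
      by (intro fg im disj sub) auto
    then obtain x y z where xyz: "x < k" "y \<in> {k..<2 * k}" "z \<in> {2 * k..<3 * k}"
      and r: "red f g m {\<phi> x, \<phi> y, \<phi> z}" by auto
    have "{x, y, z} \<in> nsets {..<n} 3"
      using xyz n by (auto simp: nsets_def)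
    then have "\<phi> ` {x, y, z} \<in> colour_class N \<chi> Blue"
      using \<phi>(3) by blast
    with r show False
      by (simp add: colour_class_def \<chi>_def)
  qed
qed

section \<open>Choice of the parameters and asymptotics\<close>

lemma binomial_le_power: "n choose k \<le> n ^ k"
  by (cases "k \<le> n") (simp_all add: binomial_le_pow binomial_eq_0)

text \<open>Working with cubes \<open>k = r ^ 3\<close> keeps \<open>k\<close> to the power 2/3 a
  natural number. With \<open>s = r\<^sup>2\<close> and \<open>m = 4 * s\<close>, both kinds of
  failure have probability exponentially small in \<open>r ^ 5\<close>, and the number of
  \<open>k\<close>-sets is at most \<open>exp (r ^ 5 / 100000)\<close>.\<close>

lemma eventually_not_ramsey_prop:
  fixes V :: "'a set" and E :: "'a set set"
  assumes H: "three_graph V E" "tightly_connected E" "\<not> tripartite V E"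
  shows "eventually (\<lambda>r::nat. \<forall>n N. 3 * r ^ 3 \<le> n \<longrightarrow> real N \<le> exp (real r ^ 2 / 100000) \<longrightarrow>
           \<not> ramsey_prop V E n N) at_top"
proof -
  have ev1: "eventually (\<lambda>r::nat. 3 * (9 / 10 :: real) ^ (r ^ 3) \<le> 1) at_top"
    by real_asymp
  \<comment> \<open>For \<open>small_f\<close>, with 2 and 3 replaced by \<open>exp 1\<close> and
    \<open>exp 2\<close>. The coefficient of \<open>r ^ 5\<close> is
    \<open>1 / 100000 - 1 / 10\<close>, which is negative.\<close>
  have ev2: "eventually (\<lambda>r::nat. exp (real r ^ 5 / 100000 + 4 * real r ^ 2 + (2 - real r ^ 3 / 10) * real r ^ 2) < 1) at_top"
    by real_asymp
  \<comment> \<open>Here \<open>L / (4 * m ^ 3)\<close> equals \<open>r\<^sup>2 / 25600\<close>. The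
    second summand decays like \<open>exp (- 2 * r\<^sup>2)\<close> up to lower order, and weakening
    25600 to 26000 absorbs it.\<close>
  have ev3: "eventually (\<lambda>r::nat. exp (- (real r ^ 2 / 25600)) + 4 * real r ^ 2 * exp (real r / 4 - 2 * real r ^ 2)
      \<le> exp (- (real r ^ 2 / 26000))) at_top"
    by real_asymp
  \<comment> \<open>For \<open>small_g\<close>: the cubed binomial costs \<open>3 / 100000\<close>
    in the coefficient of \<open>r ^ 5\<close>, which is less than the gain
    \<open>1 / 26000\<close>.\<close>
  have ev4: "eventually (\<lambda>r::nat. exp (3 * real r ^ 5 / 100000) *
      (exp (- (real r ^ 5 / 26000)) + exp (- (real r ^ 6 / 400))) < 1) at_top"
    by real_asymp
  show ?thesis
    using ev1 ev2 ev3 ev4 eventually_gt_at_top[of 0]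
  proof eventually_elim
    case (elim r)
    define k s m where "k = r ^ 3" and "s = r\<^sup>2" and "m = 4 * s"
    define x where "x = real r"
    have x: "x > 0" using elim by (simp add: x_def)
    have rk: "real k = x ^ 3" and rs: "real s = x ^ 2" and rm: "real m = 4 * x ^ 2"
      by (simp_all add: k_def s_def m_def x_def)
    have half: "(1 / 2 :: real) \<le> exp (- (1 / 2))" and "(9 / 10 :: real) \<le> exp (- (1 / 10))"
      and two: "(2 :: real) \<le> exp 1"
      using exp_ge_add_one_self[of "- (1 / 2) :: real"] exp_ge_add_one_self[of "- (1 / 10) :: real"]
        exp_ge_add_one_self[of "1 :: real"] by simp_all
    then have ninth: "(9 / 10 :: real) ^ k \<le> exp (- (x ^ 3 / 10))"
      using power_mono[of "9 / 10 :: real" "exp (- (1 / 10))" k] rk by (simp add: exp_of_nat_mult [symmetric])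
    have three: "(3 :: real) \<le> exp 2"
      using exp_ge_add_one_self[of "2 :: real"] by simp
    show ?case
    proof (intro allI impI)
      fix n N assume n: "3 * r ^ 3 \<le> n" and N: "real N \<le> exp (real r ^ 2 / 100000)"
      have "real (N choose k) \<le> real (N ^ k)"
        by (intro of_nat_mono binomial_le_power)
      also have "\<dots> = real N ^ k" by simp
      also have "\<dots> \<le> exp (x ^ 2 / 100000) ^ k"
        using N by (intro power_mono) (auto simp: x_def)
      also have "\<dots> = exp (x ^ 5 / 100000)"
        by (simp add: exp_of_nat_mult [symmetric] rk power_add [symmetric])
      finally have choose: "real (N choose k) \<le> exp (x ^ 5 / 100000)" .
      show "\<not> ramsey_prop V E n N"
      proof (rule not_ramsey_prop[OF H])
        show "3 * k \<le> n" using n by (simp add: k_def)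
        show "m = 4 * s" by (simp add: m_def)
        show "s > 0" using elim by (simp add: s_def)
        have "r ^ 3 \<le> r ^ 4" using elim by (intro power_increasing) auto
        then show "k \<le> 2 * m\<^sup>2"
          by (simp add: k_def m_def s_def power_mult_distrib flip: power_mult)
        show "3 * (9 / 10 :: real) ^ k \<le> 1" using elim by (simp add: k_def)
        have "real (N choose k) * 2 ^ m * (3 * (9 / 10) ^ k) ^ s
           \<le> exp (x ^ 5 / 100000) * exp 1 ^ m * (exp 2 * exp (- (x ^ 3 / 10))) ^ s"
          using choose two three ninth by (intro mult_mono power_mono) auto
        also have "\<dots> = exp (x ^ 5 / 100000 + 4 * x ^ 2 + (2 - x ^ 3 / 10) * x ^ 2)"
          by (simp add: exp_of_nat_mult [symmetric] rm rs exp_add [symmetric] algebra_simps)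
        also have "\<dots> < 1" using elim by (simp add: x_def)
        finally show "real (N choose k) * 2 ^ m * (3 * (9 / 10) ^ k) ^ s < 1" .
        define L where "L = real s * (real k)\<^sup>2 / 100"
        have L: "L = x ^ 8 / 100"
          by (simp add: L_def rk rs power_add [symmetric] flip: power_mult)
        have L3: "- L / (4 * real m ^ 3) = - (x ^ 2 / 25600)"
          using x by (simp add: L rm power_mult_distrib field_simps flip: power_mult power_add)
        have L1: "- L / real m = - (x ^ 6 / 400)"
          using x by (simp add: L rm field_simps flip: power_add)
        have "(1 + 1 / real m) ^ k \<le> exp (1 / real m) ^ k"
          by (intro power_mono) auto
        also have "\<dots> = exp (x / 4)"
          using x by (simp add: exp_of_nat_mult [symmetric] rk rm power2_eq_square power3_eq_cube)
        finally have pw: "(1 + 1 / real m) ^ k \<le> exp (x / 4)" .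
        have "(1 / 2) ^ m \<le> exp (- (1 / 2) :: real) ^ m"
          using half by (intro power_mono) auto
        also have "\<dots> = exp (- 2 * x ^ 2)"
          by (simp add: exp_of_nat_mult [symmetric] rm)
        finally have hm: "(1 / 2 :: real) ^ m \<le> exp (- 2 * x ^ 2)" .
        have "real m * (1 + 1 / real m) ^ k / 2 ^ m = 4 * x ^ 2 * ((1 + 1 / real m) ^ k * (1 / 2) ^ m)"
          by (simp add: rm power_divide)
        also have "\<dots> \<le> 4 * x ^ 2 * (exp (x / 4) * exp (- 2 * x ^ 2))"
          using pw hm x by (intro mult_left_mono mult_mono) auto
        also have "exp (x / 4) * exp (- 2 * x ^ 2) = exp (x / 4 - 2 * x ^ 2)"
          by (simp flip: exp_add)
        finally have "exp (- L / (4 * real m ^ 3)) + real m * (1 + 1 / real m) ^ k / 2 ^ m \<le> exp (- (x ^ 2 / 26000))"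
          using elim unfolding L3 x_def by linarith
        then have "(exp (- L / (4 * real m ^ 3)) + real m * (1 + 1 / real m) ^ k / 2 ^ m) ^ k \<le> exp (- (x ^ 2 / 26000)) ^ k"
          by (intro power_mono) auto
        also have "\<dots> = exp (- (x ^ 5 / 26000))"
          by (simp add: exp_of_nat_mult [symmetric] rk power_add [symmetric])
        finally have "(exp (- L / (4 * real m ^ 3)) + real m * (1 + 1 / real m) ^ k / 2 ^ m) ^ k + exp (- L / real m)
            \<le> exp (- (x ^ 5 / 26000)) + exp (- (x ^ 6 / 400))"
          unfolding L1 by simp
        moreover have "real (N choose k) ^ 3 \<le> exp (3 * x ^ 5 / 100000)"
          using power_mono[OF choose, of 3] by (simp add: exp_of_nat_mult [symmetric])
        ultimately have "real (N choose k) ^ 3 *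
          ((exp (- L / (4 * real m ^ 3)) + real m * (1 + 1 / real m) ^ k / 2 ^ m) ^ k + exp (- L / real m))
           \<le> exp (3 * x ^ 5 / 100000) * (exp (- (x ^ 5 / 26000)) + exp (- (x ^ 6 / 400)))"
          by (intro mult_mono) auto
        also have "\<dots> < 1" using elim by (simp add: x_def)
        finally show "real (N choose k) ^ 3 * ((exp (- (real s * (real k)\<^sup>2 / 100) / (4 * real m ^ 3)) +
            real m * (1 + 1 / real m) ^ k / 2 ^ m) ^ k + exp (- (real s * (real k)\<^sup>2 / 100) / real m)) < 1"
          unfolding L_def .
      qed
    qed
  qed
qed

theorem theorem1p2:
  fixes V :: "'a set" and E :: "'a set set"
  assumes "three_graph V E"
    and "tightly_connected E"
    and "\<not> tripartite V E"
  shows "\<exists>c::real. c > 0 \<and> (\<exists>n0::nat. \<forall>n\<ge>n0.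
           real (ramsey_number V E n) \<ge> 2 powr (c * real n powr (2 / 3)))"
proof -
  obtain r0 where r0: "\<And>r n N. r \<ge> r0 \<Longrightarrow> 3 * r ^ 3 \<le> n \<Longrightarrow>
      real N \<le> exp (real r ^ 2 / 100000) \<Longrightarrow> \<not> ramsey_prop V E n N"
    using eventually_not_ramsey_prop[OF assms] unfolding eventually_at_top_linorder by blast
  \<comment> \<open>The constant is \<open>1 / (9 * 100000)\<close>: below,
    \<open>n powr (2 / 3)\<close> is at most \<open>9 * r\<^sup>2\<close>, and the base 2 is at most
    \<open>exp 1\<close>.\<close>
  have "2 powr (1 / 900000 * real n powr (2 / 3)) \<le> real (ramsey_number V E n)"
    if n: "n \<ge> 3 * (r0 + 1) ^ 3" for n
  proof -
    \<comment> \<open>The largest cube that fits into \<open>n\<close>. The lower bound on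
      \<open>n\<close> makes \<open>r0 + 1\<close> a candidate, and \<open>bound\<close> guarantees
      that the maximum exists.\<close>
    define r where "r = (GREATEST r. 3 * r ^ 3 \<le> n)"
    have bound: "y \<le> n" if "3 * y ^ 3 \<le> n" for y
    proof -
      have "y \<le> y ^ 3" by (cases "y = 0") (auto intro: self_le_power)
      with that show ?thesis by linarith
    qed
    have r: "3 * r ^ 3 \<le> n"
      unfolding r_def using n bound by (rule GreatestI_nat)
    have rr: "r0 + 1 \<le> r"
      unfolding r_def using n bound by (rule Greatest_le_nat)
    have "\<not> 3 * (r + 1) ^ 3 \<le> n"
    proof
      assume "3 * (r + 1) ^ 3 \<le> n"
      then have "r + 1 \<le> r"
        unfolding r_def using bound by (rule Greatest_le_nat)
      then show False by simp
    qed
    then have "n \<le> 3 * (r + 1) ^ 3" by simp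
    \<comment> \<open>As \<open>r\<close> is at least 1, \<open>r + 1\<close> is at most
      \<open>2 * r\<close>; then \<open>3 * 8 \<le> 27\<close> leads to the clean cube
      \<open>(3 * r) ^ 3\<close>.\<close>
    also have "\<dots> \<le> 3 * (2 * r) ^ 3"
      using rr by (intro mult_left_mono power_mono) auto
    also have "\<dots> \<le> (3 * r) ^ 3" by (simp add: power_mult_distrib)
    finally have "real n \<le> real ((3 * r) ^ 3)" by (rule of_nat_mono)
    then have "real n \<le> (3 * real r) ^ 3" by simp
    also have "\<dots> = (3 * real r) powr 3"
      using rr by (simp add: powr_numeral)
    finally have "real n powr (2 / 3) \<le> ((3 * real r) powr 3) powr (2 / 3)"
      by (intro powr_mono2) auto
    also have "\<dots> = (3 * real r) powr 2"
      by (simp only: powr_powr) simp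
    also have "\<dots> = 9 * real r ^ 2"
      using rr by (simp add: powr_numeral power_mult_distrib)
    finally have n23: "real n powr (2 / 3) \<le> 9 * real r ^ 2" .
    have "2 powr (1 / 900000 * real n powr (2 / 3)) \<le> exp 1 powr (1 / 900000 * real n powr (2 / 3))"
      using exp_ge_add_one_self[of "1 :: real"] by (intro powr_mono2) auto
    also have "\<dots> \<le> exp (real r ^ 2 / 100000)"
      using n23 by (simp add: powr_def)
    finally have le: "2 powr (1 / 900000 * real n powr (2 / 3)) \<le> exp (real r ^ 2 / 100000)" .
    \<comment> \<open>The least \<open>N\<close> has the property because some \<open>N\<close> has
      it, so the Ramsey number itself cannot lie in the excluded range.\<close>
    have "ramsey_prop V E n (ramsey_number V E n)"
      unfolding ramsey_number_def using ramsey_prop_exists[OF assms(1)] by (rule LeastI_ex)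
    then have "\<not> real (ramsey_number V E n) \<le> exp (real r ^ 2 / 100000)"
      using r0[of r n] r rr by auto
    with le show ?thesis by linarith
  qed
  then show ?thesis
    by (intro exI[of _ "1 / 900000"] conjI exI[of _ "3 * (r0 + 1) ^ 3"]) auto
qed

end
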